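(* Let $(x_j)$ be a normalized, bimonotone, weakly null sequence in a real Banach space $X$. Then exactly one of the following two alternatives holds: (1) There exists a subsequence of $(x_j)$ which is boundedly convexly complete. (2) Every subsequence of $(x_j)$ admits a convex block subsequence equivalent to the unit vector basis of $c_0$.
   Context: A sequence $(x_j)$ is bimonotone if for every finitely supported scalar sequence $(a_i)$ and every $n$, $\max\{\|\sum_{i=1}^n a_ix_i\|,\|\sum_{i>n}a_ix_i\|\}\le\|\sum_i a_ix_i\|$. A sequence $(y_j)$ is strongly bounded if $\sup_n\|\sum_{j=1}^n y_j\|<\infty$. For a sequence $s=(x_j)$ and scalars $\boldsymbol a=(a_j)$, put $\tau_n(\boldsymbol a,s)=\sup\{\|\sum_{j\in F}a_jx_j\|: F\subset\mathbb N \text{ finite},\ n\le\min F,\ \sum_{j\in F}|a_j|\le 1\}$ and $\tau(\boldsymbol a,s)=\lim_n\tau_n(\boldsymbol a,s)$. A weakly null sequence $s=(x_j)$ is boundedly convexly complete (b.c.c.) if for every scalar sequence $\boldsymbol a=(a_j)$ such that $(a_jx_j)$ is strongly bounded we have $\tau(\boldsymbol a,s)=0$. A convex block subsequence of $(x_n)$ is a sequence $y_i=\sum_{n\in F_i}a_nx_n$ where $F_1<F_2<\cdots$ are finite subsets of $\mathbb N$ (i.e. $\max F_i<\min F_{i+1}$), $a_n\ge0$ and $\sum_{n\in F_i}a_n=1$. A semi-normalized sequence $(y_j)$ (i.e. $0<\inf\|y_j\|\le\sup\|y_j\|<\infty$) is equivalent to the unit vector basis of $c_0$ if there is $C>0$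 with $\|\sum_{j=1}^na_jy_j\|\le C\max_{j\le n}|a_j|$ for all $n$ and all scalars. *)

theory Defs
  imports "HOL-Analysis.Analysis"
begin

definition weakly_null :: "(nat \<Rightarrow> 'a::real_normed_vector) \<Rightarrow> bool" where
  "weakly_null x \<longleftrightarrow> (\<forall>f::'a \<Rightarrow> real. bounded_linear f \<longrightarrow> (\<lambda>j. f (x j)) \<longlonglongrightarrow> 0)"

definition normalized :: "(nat \<Rightarrow> 'a::real_normed_vector) \<Rightarrow> bool" where
  "normalized x \<longleftrightarrow> (\<forall>j. norm (x j) = 1)"

definition bimonotone :: "(nat \<Rightarrow> 'a::real_normed_vector) \<Rightarrow> bool" where
  "bimonotone x \<longleftrightarrow> (\<forall>(a::nat \<Rightarrow> real) n. finite {i. a i \<noteq> 0} \<longrightarrow>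
      max (norm (\<Sum>i\<in>{i. a i \<noteq> 0 \<and> i < n}. a i *\<^sub>R x i))
          (norm (\<Sum>i\<in>{i. a i \<noteq> 0 \<and> n \<le> i}. a i *\<^sub>R x i))
        \<le> norm (\<Sum>i\<in>{i. a i \<noteq> 0}. a i *\<^sub>R x i))"

definition strongly_bounded :: "(nat \<Rightarrow> 'a::real_normed_vector) \<Rightarrow> bool" where
  "strongly_bounded y \<longleftrightarrow> (\<exists>M. \<forall>n. norm (\<Sum>j<n. y j) \<le> M)"

definition tau_n :: "(nat \<Rightarrow> real) \<Rightarrow> (nat \<Rightarrow> 'a::real_normed_vector) \<Rightarrow> nat \<Rightarrow> real" where
  "tau_n a x n = Sup {norm (\<Sum>j\<in>F. a j *\<^sub>R x j) | F. finite F \<and> (\<forall>j\<in>F. n \<le> j) \<and> (\<Sum>j\<in>F. \<bar>a j\<bar>) \<le> 1}"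

text \<open>tau(a,s) = lim_n tau_n(a,s); "tau(a,s) = 0" is rendered as tau_n(a,s) \<longrightarrow> 0.\<close>
definition bcc :: "(nat \<Rightarrow> 'a::real_normed_vector) \<Rightarrow> bool" where
  "bcc x \<longleftrightarrow> weakly_null x \<and>
     (\<forall>a::nat \<Rightarrow> real. strongly_bounded (\<lambda>j. a j *\<^sub>R x j) \<longrightarrow> (\<lambda>n. tau_n a x n) \<longlonglongrightarrow> 0)"

definition convex_block_subseq :: "(nat \<Rightarrow> 'a::real_normed_vector) \<Rightarrow> (nat \<Rightarrow> 'a) \<Rightarrow> bool" where
  "convex_block_subseq y x \<longleftrightarrow> (\<exists>(F::nat \<Rightarrow> nat set) (c::nat \<Rightarrow> real).
     (\<forall>i. finite (F i) \<and> F i \<noteq> {}) \<and>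
     (\<forall>i. Max (F i) < Min (F (Suc i))) \<and>
     (\<forall>n. 0 \<le> c n) \<and>
     (\<forall>i. (\<Sum>n\<in>F i. c n) = 1) \<and>
     (\<forall>i. y i = (\<Sum>n\<in>F i. c n *\<^sub>R x n)))"

definition semi_normalized :: "(nat \<Rightarrow> 'a::real_normed_vector) \<Rightarrow> bool" where
  "semi_normalized y \<longleftrightarrow> 0 < (INF j. norm (y j)) \<and> bdd_above (range (\<lambda>j. norm (y j)))"

definition equiv_c0_basis :: "(nat \<Rightarrow> 'a::real_normed_vector) \<Rightarrow> bool" where
  "equiv_c0_basis y \<longleftrightarrow> semi_normalized y \<and>
     (\<exists>C>0. \<forall>(a::nat \<Rightarrow> real) n. norm (\<Sum>j\<le>n. a j *\<^sub>R y j) \<le> C * (MAX j\<in>{..n}. \<bar>a j\<bar>))"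

end

theory Submission
  imports Defs
begin

text \<open>
  That the alternatives exclude each other is easy: the coefficients of a convex block sequence equivalent
  to the basis of \<open>c\<^sub>0\<close> are strongly bounded and do not have vanishing \<open>\<tau>\<close>. Conversely suppose that no subsequence
  is boundedly convexly complete. Then every infinite set \<open>L\<close> of indices carries a strongly bounded coefficient
  sequence which gives mass bounded below to sets \<open>T\<close>, arbitrarily far out, in the compact family \<open>fam \<delta>\<close> of those
  \<open>T\<close> on which some functional of norm one is at least \<open>\<delta>\<close>; after a diagonalization \<open>\<delta>\<close> does not depend on \<open>L\<close>.
  Among the families obtained from \<open>fam \<delta>\<close> by repeatedly fixing first elements choose a minimal \<open>\<S>\<close> that is still
  charged in this way. Cut sets of indices into pieces that are minimal outside \<open>\<S>\<close>. By Galvin's lemma there is an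
  infinite set on which one of two things happens. Either every infinite subset begins with pieces on which a
  functional is positive with large sum of minima; this functional can be made small off the pieces (Elton's
  argument), which contradicts the boundedness of the coefficients. Or these sums of minima are uniformly bounded.
  Minimality of \<open>\<S>\<close> then provides probability measures, with supports in \<open>fam \<delta>\<close>, for which every set of
  non-negligible measure contains a piece up to its first element, and their barycentres are the blocks sought.
\<close>

section \<open>Ramsey theory for families of finite sets\<close>

text \<open>A piece keeps its first element as a marker because of the form in which minimality is
  available. Fixing one more point \<open>l\<close> gives a family that charges no infinite subset,
  so there are probability measures under which every \<open>T\<close> with
  \<open>insert l T\<close> in \<S> has small mass. A heavy set together with \<open>l\<close> is
  then outside \<S> and contains a piece beginning with \<open>l\<close>. The marker lies outside
  the support of the measure, and a functional may be as low as -1 there, so a coefficient sequence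
  helps only if its entry at the marker is negligible. This obstacle forces two cases. Either some
  infinite set is charged even by sets with at most one point; then the pieces are pairs, the
  markers are kept off the support of the coefficients, and point masses serve as measures. Or, on a
  suitable infinite set, the entries of every bounded coefficient sequence are eventually below any
  positive constant, and markers far out cost little. The minimal family enters in this second
  case.\<close>

lemma infinite_Int_greaterThan:
  "infinite (N::nat set) \<Longrightarrow> infinite (N \<inter> {m<..})"
proof
  assume "infinite N" "finite (N \<inter> {m<..})"
  then have "finite (N \<inter> {m<..} \<union> {..m})" by simp
  moreover have "N \<subseteq> N \<inter> {m<..} \<union> {..m}" by auto
  ultimately show False using \<open>infinite N\<close> finite_subset by blast
qed

lemma infinite_Int_atLeast:
  assumes "infinite (N::nat set)" shows "infinite (N \<inter> {m..})"
proof -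
  have "N \<inter> {m<..} \<subseteq> N \<inter> {m..}" by auto
  then show ?thesis using infinite_Int_greaterThan[OF assms] finite_subset by blast
qed

text \<open>A decreasing sequence of infinite sets is built in which each set contributes its least
  element and the next set is chosen beyond that element. All later elements of the diagonal set
  come from the set chosen for \<open>m\<close>, so \<open>her\<close> carries \<open>R m\<close>
  over to them.\<close>

lemma fusion:
  fixes R :: "nat \<Rightarrow> nat set \<Rightarrow> bool" and M :: "nat set"
  assumes inf: "infinite M"
    and ex: "\<And>m N. infinite N \<Longrightarrow> N \<subseteq> M \<Longrightarrow> \<exists>L\<subseteq>N. infinite L \<and> R m L"
    and her: "\<And>m N L. R m N \<Longrightarrow> L \<subseteq> N \<Longrightarrow> infinite L \<Longrightarrow> R m L"
  shows "\<exists>L\<subseteq>M. infinite L \<and> (\<forall>m\<in>L. R m (L \<inter> {m<..}))"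
proof -
  define P where "P N \<longleftrightarrow> N \<subseteq> M \<and> infinite N" for N :: "nat set"
  have "\<exists>f. \<forall>n. P (f n) \<and> (f (Suc n) \<subseteq> f n \<inter> {Inf (f n)<..} \<and> R (Inf (f n)) (f (Suc n)))"
  proof (rule dependent_nat_choice)
    show "\<exists>N. P N" using inf unfolding P_def by blast
  next
    fix N and n :: nat
    assume "P N"
    then have "infinite (N \<inter> {Inf N<..})" "N \<inter> {Inf N<..} \<subseteq> M"
      using infinite_Int_greaterThan unfolding P_def by auto
    from ex[OF this, of "Inf N"]
    obtain L where "L \<subseteq> N \<inter> {Inf N<..}" "infinite L" "R (Inf N) L" by blast
    moreover from this have "P L" using \<open>P N\<close> unfolding P_def by blast
    ultimately show "\<exists>L. P L \<and> (L \<subseteq> N \<inter> {Inf N<..} \<and> R (Inf N) L)" by blast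
  qed
  then obtain f where f: "\<And>n. f n \<subseteq> M" "\<And>n. infinite (f n)"
      "\<And>n. f (Suc n) \<subseteq> f n \<inter> {Inf (f n)<..}" "\<And>n. R (Inf (f n)) (f (Suc n))"
    unfolding P_def by blast
  have dec: "f n \<subseteq> f m" if "m \<le> n" for m n
  proof (rule lift_Suc_antimono_le[OF _ that])
    show "f (Suc n) \<subseteq> f n" for n using f(3)[of n] by blast
  qed
  define g where "g n = Inf (f n)" for n
  have g_in: "g n \<in> f n" for n
    unfolding g_def using f(2)[of n] Inf_nat_def1 finite.emptyI by metis
  have "g n < g (Suc n)" for n
    using subsetD[OF f(3) g_in[of "Suc n"]] by (simp add: g_def)
  then have mono: "strict_mono g" by (simp add: strict_mono_Suc_iff)
  have "infinite (range g)"
    by (intro range_inj_infinite strict_mono_imp_inj_on mono)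
  moreover have "range g \<subseteq> M" using g_in f(1) by blast
  moreover have "R m (range g \<inter> {m<..})" if m: "m \<in> range g" for m
  proof -
    obtain n where n: "m = g n" using m by blast
    have "range g \<inter> {m<..} \<subseteq> f (Suc n)"
    proof
      fix y assume "y \<in> range g \<inter> {m<..}"
      then obtain i where "y = g i" "g n < g i" using n by auto
      then have "n < i" using mono by (simp add: strict_mono_less)
      then show "y \<in> f (Suc n)" using g_in[of i] dec[of "Suc n" i] \<open>y = g i\<close> by auto
    qed
    then show ?thesis
      using her[OF f(4)[of n]] infinite_Int_greaterThan[OF \<open>infinite (range g)\<close>, of m] n by (simp add: g_def)
  qed
  ultimately show ?thesis by blast
qed

text \<open>Countably many hereditary properties can in general be secured on one infinite set only
  up to finitely many elements each. Bundling \<open>Q 0\<close> to \<open>Q m\<close> at stage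
  \<open>m\<close> reduces this to \<open>fusion\<close>.\<close>

lemma diagonal:
  fixes Q :: "nat \<Rightarrow> nat set \<Rightarrow> bool"
  assumes inf: "infinite M"
    and ex: "\<And>n N. infinite N \<Longrightarrow> N \<subseteq> M \<Longrightarrow> \<exists>L\<subseteq>N. infinite L \<and> Q n L"
    and her: "\<And>n N L. Q n N \<Longrightarrow> L \<subseteq> N \<Longrightarrow> infinite L \<Longrightarrow> Q n L"
  shows "\<exists>L\<subseteq>M. infinite L \<and> (\<forall>n. \<exists>m. Q n (L \<inter> {m..}))"
proof -
  have "\<exists>L\<subseteq>N. infinite L \<and> (\<forall>n\<le>m. Q n L)" if N: "infinite N" "N \<subseteq> M" for m N
  proof (induction m)
    case 0 then show ?case using ex[OF N] by simp
  next
    case (Suc m)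
    then obtain L where L: "L \<subseteq> N" "infinite L" "\<forall>n\<le>m. Q n L" by blast
    then obtain L' where "L' \<subseteq> L" "infinite L'" "Q (Suc m) L'"
      using ex[OF L(2) order_trans[OF L(1) N(2)]] by blast
    moreover have "Q n L'" if "n \<le> m" for n
      using her[OF _ \<open>L' \<subseteq> L\<close> \<open>infinite L'\<close>] L(3) that by blast
    ultimately show ?case using L(1) by (intro exI[of _ L']) (auto simp: le_Suc_eq)
  qed
  moreover have "\<forall>n\<le>m. Q n L" if "\<forall>n\<le>m. Q n N" "L \<subseteq> N" "infinite L" for m N L
    using that her by blast
  ultimately obtain L where L: "L \<subseteq> M" "infinite L" "\<forall>m\<in>L. \<forall>n\<le>m. Q n (L \<inter> {m<..})"
    using fusion[OF inf, of "\<lambda>m L. \<forall>n\<le>m. Q n L"] by auto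
  have "\<exists>m. Q n (L \<inter> {m..})" for n
  proof -
    obtain m where "m \<in> L" "n \<le> m" using L(2) by (meson infinite_nat_iff_unbounded_le)
    then have "Q n (L \<inter> {Suc m..})" using L(3) by (simp add: Suc_le_eq atLeast_Suc_greaterThan)
    then show ?thesis by blast
  qed
  then show ?thesis using L by blast
qed

text \<open>Accept-reject proof: \<open>acc s N\<close> says that every end-extension of \<open>s\<close> by an infinite subset of \<open>N\<close> has
  an initial segment in the family, and a set rejecting the empty set is thinned until it rejects all its
  finite subsets.\<close>

lemma Galvin:
  fixes \<A> :: "nat set set"
  assumes inf: "infinite M"
  shows "\<exists>N\<subseteq>M. infinite N \<and>
    ((\<forall>L\<subseteq>N. infinite L \<longrightarrow> (\<exists>n. L \<inter> {..<n} \<in> \<A>)) \<or> (\<forall>s\<subseteq>N. finite s \<longrightarrow> s \<notin> \<A>))"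
proof -
  define acc where "acc s N \<longleftrightarrow>
    (\<forall>L\<subseteq>N. infinite L \<longrightarrow> (\<forall>i\<in>s. \<forall>j\<in>L. i < j) \<longrightarrow> (\<exists>n. (s \<union> L) \<inter> {..<n} \<in> \<A>))" for s N
  define rej where "rej s N \<longleftrightarrow> (\<forall>L\<subseteq>N. infinite L \<longrightarrow> \<not> acc s L)" for s N
  have acc_mono: "acc s L" if "acc s N" "L \<subseteq> N" for s L N
    using that unfolding acc_def by blast
  have rej_mono: "rej s L" if "rej s N" "L \<subseteq> N" for s L N
    using that unfolding rej_def by blast
  have decide: "\<exists>L\<subseteq>N. infinite L \<and> (acc s L \<or> rej s L)" if "infinite N" for s N
    using that unfolding rej_def by blast
  have acc_tail: "acc s N" if "acc s (N \<inter> {m<..})" "m \<in> s" for s N m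
    unfolding acc_def
  proof (intro allI impI)
    fix L assume L: "L \<subseteq> N" "infinite L" "\<forall>i\<in>s. \<forall>j\<in>L. i < j"
    then have "L \<subseteq> N \<inter> {m<..}" using that(2) by auto
    with L that(1) show "\<exists>n. (s \<union> L) \<inter> {..<n} \<in> \<A>" unfolding acc_def by blast
  qed
  obtain N0 where N0: "N0 \<subseteq> M" "infinite N0" "acc {} N0 \<or> rej {} N0"
    using decide[OF inf] by blast
  show ?thesis
  proof (cases "acc {} N0")
    case True
    then have "\<forall>L\<subseteq>N0. infinite L \<longrightarrow> (\<exists>n. L \<inter> {..<n} \<in> \<A>)" unfolding acc_def by simp
    then show ?thesis using N0 by blast
  next
    case False
    then have rej0: "rej {} N0" using N0 by simp
    have dec_all: "\<exists>L\<subseteq>N. infinite L \<and> (\<forall>s\<in>S. acc s L \<or> rej s L)"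
      if "infinite N" "finite S" for N S
      using that(2)
    proof (induction S rule: finite_induct)
      case empty then show ?case using that by blast
    next
      case (insert s S)
      then obtain L where L: "L \<subseteq> N" "infinite L" "\<forall>s\<in>S. acc s L \<or> rej s L" by blast
      obtain L' where "L' \<subseteq> L" "infinite L'" "acc s L' \<or> rej s L'" using decide L by blast
      then show ?case using L acc_mono rej_mono by (metis insert_iff order_trans)
    qed
    have "\<exists>L\<subseteq>N0. infinite L \<and> (\<forall>m\<in>L. \<forall>s\<in>Pow {..m}. acc s (L \<inter> {m<..}) \<or> rej s (L \<inter> {m<..}))"
    proof (rule fusion[OF N0(2)])
      show "\<exists>L\<subseteq>N. infinite L \<and> (\<forall>s\<in>Pow {..m}. acc s L \<or> rej s L)" if "infinite N" for m N
        using dec_all[OF that, of "Pow {..m}"] by simp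
    qed (use acc_mono rej_mono in blast)
    then obtain N1 where N1: "N1 \<subseteq> N0" "infinite N1"
      "\<And>m s. m \<in> N1 \<Longrightarrow> s \<subseteq> {..m} \<Longrightarrow> acc s (N1 \<inter> {m<..}) \<or> rej s (N1 \<inter> {m<..})"
      by (metis PowI)
    have dec1: "acc (insert m s) N1 \<or> rej (insert m s) (N1 \<inter> {m<..})"
      if "m \<in> N1" "s \<subseteq> {..m}" for m s
      using N1(3)[of m "insert m s"] that acc_tail by auto
    define good where "good s \<longleftrightarrow> rej s (N1 \<inter> {j. \<forall>i\<in>s. i < j})" for s
    \<comment> \<open>By \<open>dec1\<close>, one-point extensions that are not good are accepted.
      Infinitely many of them would make \<open>s\<close> itself accepted: split an end-extension of
      \<open>s\<close> at its first new element.\<close>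
    have few: "finite {m\<in>N. \<not> good (insert m s)}" if s: "good s" "s \<subseteq> {..b}" "N \<subseteq> N1 \<inter> {b<..}" for s N b
    proof (rule ccontr)
      let ?X = "{m\<in>N. \<not> good (insert m s)}"
      assume infX: "infinite ?X"
      have *: "acc (insert m s) N1" if "m \<in> ?X" for m
      proof -
        have "m \<in> N1" "b < m" using that s by auto
        then have "s \<subseteq> {..m}" using s(2) by fastforce
        have "{j. \<forall>i\<in>insert m s. i < j} \<inter> N1 = N1 \<inter> {m<..}"
          using \<open>s \<subseteq> {..m}\<close> by (auto intro: le_less_trans)
        then show ?thesis
          using dec1[OF \<open>m \<in> N1\<close> \<open>s \<subseteq> {..m}\<close>] that unfolding good_def by (auto simp: Int_commute)
      qed
      have "acc s ?X"
        unfolding acc_def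
      proof (intro allI impI)
        fix L assume L: "L \<subseteq> ?X" "infinite L" "\<forall>i\<in>s. \<forall>j\<in>L. i < j"
        define m where "m = Inf L"
        have m: "m \<in> L" unfolding m_def using L by (intro Inf_nat_def1) auto
        have less: "m < j" if "j \<in> L - {m}" for j
          using that by (metis DiffE insertCI m_def wellorder_Inf_le1 le_neq_implies_less)
        have "\<exists>n. (insert m s \<union> (L - {m})) \<inter> {..<n} \<in> \<A>"
        proof -
          have "L - {m} \<subseteq> N1" "infinite (L - {m})" using L(1,2) s(3) by auto
          moreover have "\<forall>i\<in>insert m s. \<forall>j\<in>L - {m}. i < j" using L(3) less by auto
          ultimately show ?thesis using *[of m] m L(1) unfolding acc_def by blast
        qed
        moreover have "insert m s \<union> (L - {m}) = s \<union> L" using m by auto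
        ultimately show "\<exists>n. (s \<union> L) \<inter> {..<n} \<in> \<A>" by simp
      qed
      moreover have "?X \<subseteq> N1 \<inter> {j. \<forall>i\<in>s. i < j}" using s by (auto intro: le_less_trans)
      ultimately show False using s(1) infX unfolding good_def rej_def by blast
    qed
    have "\<exists>L\<subseteq>N1. infinite L \<and> (\<forall>m\<in>L. \<forall>s\<in>Pow {..m}. good s \<longrightarrow> (\<forall>j\<in>L \<inter> {m<..}. good (insert j s)))"
    proof (rule fusion[OF N1(2)])
      fix m N assume N: "infinite N" "N \<subseteq> N1"
      let ?B = "\<Union>s\<in>{s. s \<subseteq> {..m} \<and> good s}. {j\<in>N \<inter> {m<..}. \<not> good (insert j s)}"
      have "finite ?B"
        using N by (intro finite_UN_I few) auto
      then have "infinite (N \<inter> {m<..} - ?B)" using infinite_Int_greaterThan[OF N(1)] by simp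
      moreover have "\<forall>s\<in>Pow {..m}. good s \<longrightarrow> (\<forall>j\<in>N \<inter> {m<..} - ?B. good (insert j s))" by blast
      ultimately show "\<exists>L\<subseteq>N. infinite L \<and> (\<forall>s\<in>Pow {..m}. good s \<longrightarrow> (\<forall>j\<in>L. good (insert j s)))"
        by (intro exI[of _ "N \<inter> {m<..} - ?B"]) blast
    qed blast
    then obtain N2 where N2: "N2 \<subseteq> N1" "infinite N2"
      "\<And>m s j. m \<in> N2 \<Longrightarrow> s \<subseteq> {..m} \<Longrightarrow> good s \<Longrightarrow> j \<in> N2 \<Longrightarrow> m < j \<Longrightarrow> good (insert j s)"
      by (metis IntI PowI greaterThan_iff)
    \<comment> \<open>\<open>N2(3)\<close> needs an element of \<open>N2\<close> that bounds
      \<open>s\<close> from above; setting \<open>b\<close> aside provides one for the empty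
      set.\<close>
    obtain b where b: "b \<in> N2" using N2(2) by (metis finite.emptyI ex_in_conv)
    let ?N3 = "N2 \<inter> {b<..}"
    have good: "good s" if "finite s" "s \<subseteq> ?N3" for s
      using that
    proof (induction s rule: finite_linorder_max_induct)
      case empty
      then show ?case using rej_mono[OF rej0 N1(1)] by (simp add: good_def)
    next
      case (insert j s)
      then have "good s" "j \<in> N2" "b < j" by auto
      show ?case
      proof (cases "s = {}")
        case True then show ?thesis using N2(3)[of b s j] b \<open>good s\<close> \<open>j \<in> N2\<close> \<open>b < j\<close> by simp
      next
        case False
        then have "Max s \<in> N2" "s \<subseteq> {..Max s}" "Max s < j" using insert by (auto dest: Max_in)
        then show ?thesis using N2(3)[of "Max s" s j] \<open>good s\<close> \<open>j \<in> N2\<close> by blast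
      qed
    qed
    \<comment> \<open>A member of the family is an initial segment of each of its end-extensions,
      hence accepted on everything beyond it.\<close>
    have "s \<notin> \<A>" if s: "s \<subseteq> ?N3" "finite s" for s
    proof
      assume "s \<in> \<A>"
      obtain c where c: "\<forall>i\<in>s. i < c" using s(2) by (meson finite_nat_set_iff_bounded)
      let ?L = "N1 \<inter> {c<..}"
      have "acc s ?L"
        unfolding acc_def
      proof (intro allI impI)
        fix L assume "L \<subseteq> ?L"
        then have "(s \<union> L) \<inter> {..<c} = s" using c by auto
        then show "\<exists>n. (s \<union> L) \<inter> {..<n} \<in> \<A>" using \<open>s \<in> \<A>\<close> by metis
      qed
      moreover have "infinite ?L" using infinite_Int_greaterThan N1(2) by blast
      moreover have "?L \<subseteq> N1 \<inter> {j. \<forall>i\<in>s. i < j}" using c by (auto intro: less_trans)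
      ultimately show False using good[OF s(2,1)] unfolding good_def rej_def by blast
    qed
    moreover have "infinite ?N3" "?N3 \<subseteq> M"
      using infinite_Int_greaterThan N2 N1 N0 by auto
    ultimately show ?thesis by blast
  qed
qed

section \<open>Suppressing coordinates of functionals\<close>

text \<open>Models the sequences \<open>(f (x j))\<close> for \<open>f\<close> in the dual ball of a normalized weakly null sequence \<open>x\<close>;
  \<open>weakly_compact\<close> is what remains of weak* compactness combined with weak nullness.\<close>

locale coefficient_set =
  fixes K :: "(nat \<Rightarrow> real) set"
  assumes abs_le_1: "k \<in> K \<Longrightarrow> \<bar>k j\<bar> \<le> 1"
    and uminus_mem: "k \<in> K \<Longrightarrow> (\<lambda>j. - k j) \<in> K"
    and attains_1: "\<exists>k\<in>K. k j = 1"
    and weakly_compact: "0 < \<epsilon> \<Longrightarrow> infinite J \<Longrightarrow> \<exists>J0\<subseteq>J. finite J0 \<and> (\<forall>k\<in>K. \<exists>j\<in>J0. \<bar>k j\<bar> \<le> \<epsilon>)"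
begin

text \<open>If coordinate \<open>m\<close> could not be made small for infinitely many \<open>m\<close>, then by Galvin's lemma the failures could be
  realized by initial segments of one infinite set. Thinness forces these to be the same set \<open>H\<close>, so a single
  functional would be large at arbitrarily many prescribed coordinates.\<close>

lemma suppress_one:
  fixes \<B> :: "nat set set" and Q :: "nat set \<Rightarrow> (nat \<Rightarrow> real) \<Rightarrow> bool"
  assumes fin: "\<And>H. H \<in> \<B> \<Longrightarrow> finite H"
    and thin: "\<And>H H'. H \<in> \<B> \<Longrightarrow> H' \<in> \<B> \<Longrightarrow> H \<subseteq> H' \<Longrightarrow> \<forall>i\<in>H. \<forall>j\<in>H' - H. i < j \<Longrightarrow> H = H'"
    and P: "finite P" "\<forall>i\<in>P. \<forall>j\<in>N. i < j" and N: "infinite N"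
    and inv: "\<And>H. H \<in> \<B> \<Longrightarrow> H \<subseteq> P \<union> N \<Longrightarrow> \<exists>k\<in>K. Q H k \<and> (\<Sum>j\<in>P - H. \<bar>k j\<bar>) \<le> c"
    and \<epsilon>: "0 < \<epsilon>"
  shows "\<exists>m\<in>N. \<exists>N'\<subseteq>N \<inter> {m<..}. infinite N' \<and>
    (\<forall>H\<in>\<B>. H \<subseteq> insert m P \<union> N' \<longrightarrow> (\<exists>k\<in>K. Q H k \<and> (\<Sum>j\<in>insert m P - H. \<bar>k j\<bar>) \<le> c + \<epsilon>))"
proof -
  \<comment> \<open>\<open>A\<close> is the part inside \<open>P\<close> of a set that omits
    \<open>m\<close>, and \<open>p\<close> is its part beyond \<open>m\<close>. Badness means that
    no functional admissible for \<open>A \<union> p\<close> can afford the additional coordinate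
    \<open>m\<close>.\<close>
  define bad where "bad A m p \<longleftrightarrow> A \<union> p \<in> \<B> \<and>
    \<not> (\<exists>k\<in>K. Q (A \<union> p) k \<and> (\<Sum>j\<in>P - A. \<bar>k j\<bar>) + \<bar>k m\<bar> \<le> c + \<epsilon>)" for A m p
  define allbad where "allbad A m L \<longleftrightarrow> (\<forall>L'\<subseteq>L. infinite L' \<longrightarrow> (\<exists>n. L' \<inter> {..<n} \<in> Collect (bad A m)))" for A m L
  define nobad where "nobad A m L \<longleftrightarrow> (\<forall>s\<subseteq>L. finite s \<longrightarrow> s \<notin> Collect (bad A m))" for A m L
  have mono: "allbad A m L \<or> nobad A m L" if "allbad A m L' \<or> nobad A m L'" "L \<subseteq> L'" for A m L L'
    using that unfolding allbad_def nobad_def by blast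
  have "\<exists>L\<subseteq>N'. infinite L \<and> (\<forall>A\<in>\<P>. allbad A m L \<or> nobad A m L)"
    if N': "infinite N'" and "finite \<P>" for m N' \<P>
    using that(2)
  proof (induction \<P> rule: finite_induct)
    case empty
    then show ?case using N' by blast
  next
    case (insert A \<P>)
    then obtain L where L: "L \<subseteq> N'" "infinite L" "\<forall>A\<in>\<P>. allbad A m L \<or> nobad A m L" by blast
    obtain L' where L': "L' \<subseteq> L" "infinite L'" "allbad A m L' \<or> nobad A m L'"
      using Galvin[OF L(2), of "Collect (bad A m)"] unfolding allbad_def nobad_def by blast
    then have "\<forall>A\<in>insert A \<P>. allbad A m L' \<or> nobad A m L'" using L(3) mono by blast
    then show ?case using L(1) L' by blast
  qed
  from this[OF _ finite_Pow_iff[THEN iffD2, OF P(1)]]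
  have "\<exists>L\<subseteq>N. infinite L \<and> (\<forall>m\<in>L. \<forall>A\<in>Pow P. allbad A m (L \<inter> {m<..}) \<or> nobad A m (L \<inter> {m<..}))"
    by (intro fusion[OF N]) (use mono in blast)+
  then obtain N1 where N1: "N1 \<subseteq> N" "infinite N1"
    "\<And>m A. m \<in> N1 \<Longrightarrow> A \<subseteq> P \<Longrightarrow> allbad A m (N1 \<inter> {m<..}) \<or> nobad A m (N1 \<inter> {m<..})"
    by (metis PowI)
  have few: "finite {m\<in>N1. allbad A m (N1 \<inter> {m<..})}" if A: "A \<subseteq> P" for A
  proof (rule ccontr)
    assume "infinite {m\<in>N1. allbad A m (N1 \<inter> {m<..})}"
    from weakly_compact[OF \<epsilon> this]
    obtain J where J: "J \<subseteq> N1" "\<And>j. j \<in> J \<Longrightarrow> allbad A j (N1 \<inter> {j<..})"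
      "finite J" "\<And>k. k \<in> K \<Longrightarrow> \<exists>j\<in>J. \<bar>k j\<bar> \<le> \<epsilon>" by blast
    then obtain j0 where j0: "j0 \<in> J" using attains_1[of 0] by blast
    define L where "L = N1 \<inter> {Max J<..}"
    have L: "infinite L" "L \<subseteq> N" using infinite_Int_greaterThan N1 unfolding L_def by auto
    have "\<exists>n. bad A j (L \<inter> {..<n})" if "j \<in> J" for j
    proof -
      have "L \<subseteq> N1 \<inter> {j<..}" using Max_ge[OF J(3) that] unfolding L_def by auto
      then show ?thesis using J(2)[OF that] L(1) unfolding allbad_def by blast
    qed
    then obtain n where n: "\<And>j. j \<in> J \<Longrightarrow> bad A j (L \<inter> {..<n j})" by metis
    have AL: "i < j" if "i \<in> A" "j \<in> L" for i j using that A L(2) P(2) by blast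
    \<comment> \<open>One \<open>L\<close> beyond all of \<open>J\<close> serves every
      \<open>j\<close>, so these sets are initial segments of one another and \<open>thin\<close>
      identifies them.\<close>
    have same: "A \<union> L \<inter> {..<n i} = A \<union> L \<inter> {..<n j}" if "i \<in> J" "j \<in> J" "n i \<le> n j" for i j
      using that n AL by (intro thin) (auto simp: bad_def)
    define H where "H = A \<union> L \<inter> {..<n j0}"
    have H: "H = A \<union> L \<inter> {..<n j}" if "j \<in> J" for j
      unfolding H_def using same[OF j0 that] same[OF that j0] nat_le_linear by blast
    have "H \<in> \<B>" using n[OF j0] unfolding bad_def H_def by blast
    moreover have "H \<subseteq> P \<union> N" using A L(2) unfolding H_def by auto
    ultimately obtain k where k: "k \<in> K" "Q H k" "(\<Sum>j\<in>P - H. \<bar>k j\<bar>) \<le> c" using inv by blast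
    obtain j where j: "j \<in> J" "\<bar>k j\<bar> \<le> \<epsilon>" using J(4) k(1) by blast
    have "P - H = P - A" using L(2) P(2) unfolding H_def by auto
    then have "(\<Sum>j\<in>P - A. \<bar>k j\<bar>) + \<bar>k j\<bar> \<le> c + \<epsilon>" using k(3) j(2) by simp
    then show False using n[OF j(1)] k H[OF j(1)] unfolding bad_def by auto
  qed
  have "finite (\<Union>A\<in>Pow P. {m\<in>N1. allbad A m (N1 \<inter> {m<..})})"
    using few P(1) by (intro finite_UN_I) auto
  then have "infinite (N1 - (\<Union>A\<in>Pow P. {m\<in>N1. allbad A m (N1 \<inter> {m<..})}))" using N1(2) by simp
  then obtain m where "m \<in> N1 - (\<Union>A\<in>Pow P. {m\<in>N1. allbad A m (N1 \<inter> {m<..})})"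
    by (metis ex_in_conv finite.emptyI)
  then have m: "m \<in> N1" "\<And>A. A \<subseteq> P \<Longrightarrow> \<not> allbad A m (N1 \<inter> {m<..})" by auto
  let ?N = "N1 \<inter> {m<..}"
  have good: "nobad A m ?N" if "A \<subseteq> P" for A using N1(3) m that by blast
  have "m \<in> N" "m \<notin> P" using m(1) N1(1) P(2) by auto
  have "\<exists>k\<in>K. Q H k \<and> (\<Sum>j\<in>insert m P - H. \<bar>k j\<bar>) \<le> c + \<epsilon>" if H: "H \<in> \<B>" "H \<subseteq> insert m P \<union> ?N" for H
  proof (cases "m \<in> H")
    case True
    have "H \<subseteq> P \<union> N" using H(2) \<open>m \<in> N\<close> N1(1) by auto
    moreover have "insert m P - H = P - H" using True by auto
    ultimately show ?thesis using inv[OF H(1)] \<epsilon> by fastforce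
  next
    case False
    let ?A = "H \<inter> P" and ?s = "H \<inter> ?N"
    have "?A \<union> ?s = H" using H(2) False by auto
    moreover have "\<not> bad ?A m ?s" 
      using good[OF Int_lower2, of H] fin[OF H(1)] unfolding nobad_def
      by (metis Int_lower2 finite_Int mem_Collect_eq)
    ultimately obtain k where k: "k \<in> K" "Q H k" "(\<Sum>j\<in>P - ?A. \<bar>k j\<bar>) + \<bar>k m\<bar> \<le> c + \<epsilon>"
      using H(1) unfolding bad_def by metis
    have "insert m P - H = insert m (P - ?A)" using False by auto
    then have "(\<Sum>j\<in>insert m P - H. \<bar>k j\<bar>) = (\<Sum>j\<in>P - ?A. \<bar>k j\<bar>) + \<bar>k m\<bar>"
      using P(1) \<open>m \<notin> P\<close> by simp
    then show ?thesis using k by (intro bexI[of _ k]) simp_all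
  qed
  moreover have "infinite ?N" using infinite_Int_greaterThan N1(2) by blast
  moreover have "?N \<subseteq> N \<inter> {m<..}" using N1(1) by blast
  ultimately show ?thesis using \<open>m \<in> N\<close> by blast
qed

text \<open>Iterating \<open>suppress_one\<close> with tolerances \<open>(1/2)^Suc n\<close> keeps
  the total at stage \<open>n\<close> below \<open>1 - (1/2)^n\<close>. In the invariant,
  \<open>P\<close> consists of the points already chosen and \<open>N\<close> is the reservoir for
  later ones. The functional may depend on the cutoff \<open>b\<close>, because \<open>K\<close> is
  not assumed to be closed under limits.\<close>

lemma suppress:
  fixes \<B> :: "nat set set" and Q :: "nat set \<Rightarrow> (nat \<Rightarrow> real) \<Rightarrow> bool"
  assumes inf: "infinite M" and fin: "\<And>H. H \<in> \<B> \<Longrightarrow> finite H"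
    and thin: "\<And>H H'. H \<in> \<B> \<Longrightarrow> H' \<in> \<B> \<Longrightarrow> H \<subseteq> H' \<Longrightarrow> \<forall>i\<in>H. \<forall>j\<in>H' - H. i < j \<Longrightarrow> H = H'"
    and Q: "\<And>H. H \<in> \<B> \<Longrightarrow> \<exists>k\<in>K. Q H k"
  shows "\<exists>N\<subseteq>M. infinite N \<and> (\<forall>H\<in>\<B>. H \<subseteq> N \<longrightarrow> (\<forall>b. \<exists>k\<in>K. Q H k \<and> (\<Sum>j\<in>(N - H) \<inter> {..<b}. \<bar>k j\<bar>) \<le> 1))"
proof -
  define inv where "inv n X \<longleftrightarrow> (case X of (P, N) \<Rightarrow>
    finite P \<and> P \<subseteq> M \<and> N \<subseteq> M \<and> infinite N \<and> (\<forall>i\<in>P. \<forall>j\<in>N. i < j) \<and>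
    (\<forall>H\<in>\<B>. H \<subseteq> P \<union> N \<longrightarrow> (\<exists>k\<in>K. Q H k \<and> (\<Sum>j\<in>P - H. \<bar>k j\<bar>) \<le> 1 - (1/2)^n)))" for n X
  have "\<exists>f. \<forall>n. inv n (f n) \<and> fst (f n) \<subset> fst (f (Suc n))"
  proof (rule dependent_nat_choice)
    have "inv 0 ({}, M)" using inf Q unfolding inv_def by auto
    then show "\<exists>X. inv 0 X" by blast
  next
    fix X n assume X: "inv n X"
    obtain P N where [simp]: "X = (P, N)" by (cases X)
    have PN: "finite P" "P \<subseteq> M" "N \<subseteq> M" "infinite N" "\<forall>i\<in>P. \<forall>j\<in>N. i < j"
      and PN': "\<And>H. H \<in> \<B> \<Longrightarrow> H \<subseteq> P \<union> N \<Longrightarrow> \<exists>k\<in>K. Q H k \<and> (\<Sum>j\<in>P - H. \<bar>k j\<bar>) \<le> 1 - (1/2)^n"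
      using X unfolding inv_def by auto
    have "\<exists>m\<in>N. \<exists>N'\<subseteq>N \<inter> {m<..}. infinite N' \<and> (\<forall>H\<in>\<B>. H \<subseteq> insert m P \<union> N' \<longrightarrow>
        (\<exists>k\<in>K. Q H k \<and> (\<Sum>j\<in>insert m P - H. \<bar>k j\<bar>) \<le> 1 - (1/2)^n + (1/2)^Suc n))"
    proof (rule suppress_one)
      show "H = H'" if "H \<in> \<B>" "H' \<in> \<B>" "H \<subseteq> H'" "\<forall>i\<in>H. \<forall>j\<in>H' - H. i < j" for H H'
        using thin that by blast
    qed (use fin PN PN' in auto)
    then obtain m N' where m: "m \<in> N" "N' \<subseteq> N \<inter> {m<..}" "infinite N'"
      "\<forall>H\<in>\<B>. H \<subseteq> insert m P \<union> N' \<longrightarrow>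
        (\<exists>k\<in>K. Q H k \<and> (\<Sum>j\<in>insert m P - H. \<bar>k j\<bar>) \<le> 1 - (1/2)^n + (1/2)^Suc n)"
      by blast
    have "1 - (1/2)^n + (1/2)^Suc n = (1 - (1/2)^Suc n :: real)" by simp
    then have "inv (Suc n) (insert m P, N')"
      using m PN unfolding inv_def by auto
    moreover have "P \<subset> insert m P" using m(1) PN(5) by auto
    ultimately show "\<exists>Y. inv (Suc n) Y \<and> fst X \<subset> fst Y" by auto
  qed
  then obtain f where f: "\<And>n. inv n (f n)" "\<And>n. fst (f n) \<subset> fst (f (Suc n))" by blast
  define P where "P n = fst (f n)" for n
  have P: "finite (P n)" "P n \<subseteq> M"
    "\<And>H. H \<in> \<B> \<Longrightarrow> H \<subseteq> P n \<Longrightarrow> \<exists>k\<in>K. Q H k \<and> (\<Sum>j\<in>P n - H. \<bar>k j\<bar>) \<le> 1 - (1/2)^n" for n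
    using f(1)[of n] unfolding inv_def P_def by (auto split: prod.splits)
  have less: "P n \<subset> P (Suc n)" for n using f(2) unfolding P_def by blast
  have mono: "P m \<subseteq> P n" if "m \<le> n" for m n
    using less by (intro lift_Suc_mono_le[OF _ that]) blast
  define N where "N = (\<Union>n. P n)"
  have cover: "\<exists>n. F \<subseteq> P n" if "finite F" "F \<subseteq> N" for F
    using that
  proof (induction F rule: finite_induct)
    case empty then show ?case by blast
  next
    case (insert x F)
    then obtain m n where "F \<subseteq> P m" "x \<in> P n" unfolding N_def by blast
    then have "insert x F \<subseteq> P (max m n)" using mono[of m "max m n"] mono[of n "max m n"] by auto
    then show ?case by blast
  qed
  have "infinite N"
  proof
    assume "finite N"
    then obtain n where "N \<subseteq> P n" using cover by blast
    moreover have "P (Suc n) \<subseteq> N" unfolding N_def by blast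
    ultimately show False using less[of n] by blast
  qed
  moreover have "N \<subseteq> M" using P(2) unfolding N_def by blast
  moreover have "\<exists>k\<in>K. Q H k \<and> (\<Sum>j\<in>(N - H) \<inter> {..<b}. \<bar>k j\<bar>) \<le> 1" if H: "H \<in> \<B>" "H \<subseteq> N" for H b
  proof -
    have "finite (H \<union> N \<inter> {..<b})" using fin H by simp
    then obtain n where n: "H \<union> N \<inter> {..<b} \<subseteq> P n" using cover H(2) by (metis Int_lower1 Un_least)
    then obtain k where k: "k \<in> K" "Q H k" "(\<Sum>j\<in>P n - H. \<bar>k j\<bar>) \<le> 1 - (1/2)^n"
      using P(3)[OF H(1)] by blast
    have "(\<Sum>j\<in>(N - H) \<inter> {..<b}. \<bar>k j\<bar>) \<le> (\<Sum>j\<in>P n - H. \<bar>k j\<bar>)"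
      using n P(1) by (intro sum_mono2) auto
    also have "\<dots> \<le> 1" using k(3) by (smt (verit) zero_le_power divide_nonneg_nonneg)
    finally show ?thesis using k by blast
  qed
  ultimately show ?thesis by blast
qed

end

section \<open>Compact families and pieces\<close>

text \<open>The last clause is compactness in the Cantor space: all finite subsets of a limit of
  members lie in the hereditary family, so the clause forces the limit to be finite and hence a
  member.\<close>

definition compact_family :: "nat set set \<Rightarrow> bool" where
  "compact_family \<S> \<longleftrightarrow> {} \<in> \<S> \<and> (\<forall>T\<in>\<S>. finite T \<and> (\<forall>U\<subseteq>T. U \<in> \<S>)) \<and>
    (\<forall>L. infinite L \<longrightarrow> (\<exists>U\<subseteq>L. finite U \<and> U \<notin> \<S>))"

definition shift :: "nat set set \<Rightarrow> nat \<Rightarrow> nat set set" where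
  "shift \<S> l = {T. (\<forall>j\<in>T. l < j) \<and> insert l T \<in> \<S>}"

text \<open>Minimality refers to initial segments only; omitting a point other than the maximum may
  leave a set that is still outside \<S>.\<close>

definition piece :: "nat set set \<Rightarrow> nat set \<Rightarrow> bool" where
  "piece \<S> B \<longleftrightarrow> finite B \<and> B \<noteq> {} \<and> B \<notin> \<S> \<and> B - {Max B} \<in> \<S>"

definition body :: "nat set \<Rightarrow> nat set" where
  "body B = B - {Min B}"

lemma compact_familyD:
  assumes "compact_family \<S>"
  shows "{} \<in> \<S>" "T \<in> \<S> \<Longrightarrow> finite T" "T \<in> \<S> \<Longrightarrow> U \<subseteq> T \<Longrightarrow> U \<in> \<S>"
    "infinite L \<Longrightarrow> \<exists>n. L \<inter> {..<n} \<notin> \<S>"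
proof -
  assume "infinite L"
  then obtain U where U: "U \<subseteq> L" "finite U" "U \<notin> \<S>" using assms unfolding compact_family_def by blast
  then obtain n where "\<forall>i\<in>U. i < n" by (meson finite_nat_set_iff_bounded)
  then have "U \<subseteq> L \<inter> {..<n}" using U by auto
  then show "\<exists>n. L \<inter> {..<n} \<notin> \<S>" using U(3) assms unfolding compact_family_def by blast
qed (use assms in \<open>auto simp: compact_family_def\<close>)

lemma initial_piece:
  assumes "X \<inter> {..<m} \<notin> \<S>" "{} \<in> \<S>"
  obtains n where "piece \<S> (X \<inter> {..<n})"
proof -
  define n where "n = (LEAST n. X \<inter> {..<n} \<notin> \<S>)"
  have n: "X \<inter> {..<n} \<notin> \<S>" unfolding n_def by (rule LeastI[of _ m], fact assms(1))
  have below: "X \<inter> {..<i} \<in> \<S>" if "i < n" for i using not_less_Least that unfolding n_def by blast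
  have "n \<noteq> 0" using n assms(2) by (intro notI) simp
  then obtain p where p: "n = Suc p" by (cases n) auto
  have "p \<in> X"
  proof (rule ccontr)
    assume "p \<notin> X"
    then have "X \<inter> {..<n} = X \<inter> {..<p}" using p by (auto simp: less_Suc_eq)
    then show False using n below[of p] p by simp
  qed
  then have "Max (X \<inter> {..<n}) = p" using p by (intro Max_eqI) auto
  then have "X \<inter> {..<n} - {Max (X \<inter> {..<n})} = X \<inter> {..<p}" using p by auto
  then have "piece \<S> (X \<inter> {..<n})"
    using below[of p] p n \<open>p \<in> X\<close> unfolding piece_def by auto
  then show ?thesis by (rule that)
qed

text \<open>The conditions \<open>down\<close> and \<open>down'\<close> make one set an initial
  segment of the other. If it were a proper one, it would omit the maximum of the longer piece and
  lie in \<S> by heredity.\<close>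

lemma piece_unique:
  assumes cf: "compact_family \<S>" and B: "piece \<S> B" and B': "piece \<S> B'"
    and down: "\<And>x y. x \<in> B \<Longrightarrow> y \<in> B' \<Longrightarrow> y < x \<Longrightarrow> y \<in> B"
    and down': "\<And>x y. x \<in> B' \<Longrightarrow> y \<in> B \<Longrightarrow> y < x \<Longrightarrow> y \<in> B'"
  shows "B = B'"
proof -
  have *: "X = Y" if "X \<subseteq> Y" "piece \<S> X" "piece \<S> Y" "\<And>x y. x \<in> X \<Longrightarrow> y \<in> Y \<Longrightarrow> y < x \<Longrightarrow> y \<in> X"
    for X Y
  proof (rule ccontr)
    assume "X \<noteq> Y"
    have "finite Y" "Y \<noteq> {}" using that unfolding piece_def by auto
    have "Max Y \<notin> X"
    proof
      assume M: "Max Y \<in> X"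
      have "y \<in> X" if "y \<in> Y" for y
        using \<open>\<And>x y. x \<in> X \<Longrightarrow> y \<in> Y \<Longrightarrow> y < x \<Longrightarrow> y \<in> X\<close>[OF M that] Max_ge[OF \<open>finite Y\<close> that] M
        by (cases "y = Max Y") auto
      then show False using that(1) \<open>X \<noteq> Y\<close> by blast
    qed
    then have "X \<subseteq> Y - {Max Y}" using that(1) by blast
    then have "X \<in> \<S>" using that(3) compact_familyD(3)[OF cf] unfolding piece_def by blast
    then show False using that(2) unfolding piece_def by blast
  qed
  have "B \<subseteq> B' \<or> B' \<subseteq> B"
    by (metis down down' linorder_neqE_nat subsetI)
  then show ?thesis
  proof
    assume "B \<subseteq> B'"
    then show ?thesis by (rule *[OF _ B B']) (use down in blast)
  next
    assume "B' \<subseteq> B"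
    then show ?thesis by (rule *[OF _ B' B, symmetric]) (use down' in blast)
  qed
qed

text \<open>By induction each piece begins where the previous ones end, and
  \<open>piece_unique\<close> fixes its length. The lemma identifies the pieces supplied abstractly
  by \<open>supports_on\<close> with those from which a set was built and on which the coefficients
  are controlled.\<close>

lemma run_unique:
  fixes Bs Bs' :: "nat \<Rightarrow> nat set"
  assumes cf: "compact_family \<S>"
    and Bs: "\<And>i. piece \<S> (Bs i)" "\<And>i j x y. i < j \<Longrightarrow> x \<in> Bs i \<Longrightarrow> y \<in> Bs j \<Longrightarrow> x < y"
    and Bs': "\<And>i. i < n \<Longrightarrow> piece \<S> (Bs' i)"
      "\<And>i j x y. i < j \<Longrightarrow> j < n \<Longrightarrow> x \<in> Bs' i \<Longrightarrow> y \<in> Bs' j \<Longrightarrow> x < y"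
    and init: "(\<Union>i<n. Bs' i) = (\<Union>i. Bs i) \<inter> {..<b}"
    and "i < n"
  shows "Bs' i = Bs i"
  using \<open>i < n\<close>
proof (induction i rule: less_induct)
  case (less i)
  have in_range: "\<exists>p\<ge>i. x \<in> Bs p" if "x \<in> Bs' i" for x
  proof -
    have "x \<in> (\<Union>i<n. Bs' i)" using that less.prems by blast
    then obtain p where p: "x \<in> Bs p" using init by auto
    have "i \<le> p"
    proof (rule ccontr)
      assume "\<not> i \<le> p"
      then have "x \<in> Bs' p" using less.IH[of p] less.prems p by auto
      then show False using Bs'(2)[of p i x x] that less.prems \<open>\<not> i \<le> p\<close> by simp
    qed
    then show ?thesis using p by blast
  qed
  show ?case
  proof (rule piece_unique[OF cf Bs'(1)[OF less.prems] Bs(1)])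
    fix x y assume xy: "x \<in> Bs i" "y \<in> Bs' i" "y < x"
    then obtain p where "i \<le> p" "y \<in> Bs p" using in_range by blast
    then show "y \<in> Bs i" using Bs(2)[of i p x y] xy by (cases "p = i") auto
  next
    fix x y assume xy: "x \<in> Bs' i" "y \<in> Bs i" "y < x"
    have "x \<in> (\<Union>i<n. Bs' i)" using xy(1) less.prems by blast
    then have "y \<in> (\<Union>i<n. Bs' i)" using xy init by auto
    then obtain p where p: "p < n" "y \<in> Bs' p" by blast
    have "p = i"
    proof (rule linorder_cases[of p i])
      assume "p < i"
      then have "y \<in> Bs p" using less.IH[of p] p by auto
      then show "p = i" using Bs(2)[of p i y y] \<open>p < i\<close> xy by simp
    next
      assume "i < p"
      then show "p = i" using Bs'(2)[of i p x y] p xy by simp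
    qed
    then show "y \<in> Bs' i" using p by blast
  qed
qed

text \<open>The first element of each piece only serves to decide how long the piece is; functionals are
  controlled on the remaining body. The sum of the \<open>t i\<close> bounds from below what any positive measure
  of unit mass on each body sees of \<open>k\<close>, whatever the distribution of the mass.\<close>

definition supports_on :: "nat set set \<Rightarrow> real \<Rightarrow> nat set \<Rightarrow> (nat \<Rightarrow> real) \<Rightarrow> bool" where
  "supports_on \<S> C H k \<longleftrightarrow> (\<exists>(n::nat) Bs t. (\<forall>i<n. piece \<S> (Bs i)) \<and>
    (\<forall>i j x y. i < j \<longrightarrow> j < n \<longrightarrow> x \<in> Bs i \<longrightarrow> y \<in> Bs j \<longrightarrow> x < y) \<and> H = (\<Union>i<n. Bs i) \<and>
    (\<forall>i<n. 0 \<le> t i \<and> (\<forall>j\<in>body (Bs i). t i \<le> k j)) \<and> C \<le> (\<Sum>i<n. t i))"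

lemma supports_onE:
  assumes "supports_on \<S> C H k"
  obtains n :: nat and Bs t where "\<And>i. i < n \<Longrightarrow> piece \<S> (Bs i)"
    "\<And>i j x y. i < j \<Longrightarrow> j < n \<Longrightarrow> x \<in> Bs i \<Longrightarrow> y \<in> Bs j \<Longrightarrow> x < y" "H = (\<Union>i<n. Bs i)"
    "\<And>i. i < n \<Longrightarrow> 0 \<le> t i" "\<And>i j. i < n \<Longrightarrow> j \<in> body (Bs i) \<Longrightarrow> t i \<le> k j" "C \<le> (\<Sum>i<n. t i)"
proof -
  from assms obtain n :: nat and Bs t where *: "(\<forall>i<n. piece \<S> (Bs i)) \<and>
    (\<forall>i j x y. i < j \<longrightarrow> j < n \<longrightarrow> x \<in> Bs i \<longrightarrow> y \<in> Bs j \<longrightarrow> x < y) \<and> H = (\<Union>i<n. Bs i) \<and>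
    (\<forall>i<n. 0 \<le> t i \<and> (\<forall>j\<in>body (Bs i). t i \<le> k j)) \<and> C \<le> (\<Sum>i<n. t i)"
    unfolding supports_on_def by (elim exE) (rule that)
  show ?thesis by (rule that[of n Bs t]) (use * in blast)+
qed

lemma supports_on_finite: "supports_on \<S> C H k \<Longrightarrow> finite H"
  unfolding supports_on_def piece_def by auto

context coefficient_set
begin

definition fam :: "real \<Rightarrow> nat set set" where
  "fam \<delta> = {T. finite T \<and> (\<exists>k\<in>K. \<forall>j\<in>T. \<delta> \<le> k j)}"

text \<open>Strong boundedness tested by functionals and scaled to the bound 1. Since entries off
  \<open>L\<close> vanish, \<open>L\<close> plays the role of a subsequence while \<open>K\<close>
  stays fixed.\<close>

definition bounded_coeffs :: "nat set \<Rightarrow> (nat \<Rightarrow> real) \<Rightarrow> bool" where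
  "bounded_coeffs L a \<longleftrightarrow> (\<forall>j. j \<notin> L \<longrightarrow> a j = 0) \<and> (\<forall>j. \<bar>a j\<bar> \<le> 1) \<and>
    (\<forall>k\<in>K. \<forall>n. \<bar>\<Sum>j<n. a j * k j\<bar> \<le> 1)"

text \<open>By \<open>weakly_compact\<close>, every infinite set has a finite part on which each
  functional takes some value of modulus at most \<open>\<delta>/2\<close>, which is strictly below
  the level required in \<open>fam \<delta>\<close>.\<close>

lemma compact_family_fam:
  assumes "0 < \<delta>" shows "compact_family (fam \<delta>)"
  unfolding compact_family_def
proof (intro conjI ballI allI impI)
  show "{} \<in> fam \<delta>" using attains_1 unfolding fam_def by auto
next
  fix T assume "T \<in> fam \<delta>"
  then show "finite T" "\<And>U. U \<subseteq> T \<Longrightarrow> U \<in> fam \<delta>" unfolding fam_def by (auto intro: finite_subset)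
next
  fix L :: "nat set" assume "infinite L"
  then obtain J where J: "J \<subseteq> L" "finite J" "\<forall>k\<in>K. \<exists>j\<in>J. \<bar>k j\<bar> \<le> \<delta>/2"
    using weakly_compact[of "\<delta>/2" L] assms by auto
  have "J \<notin> fam \<delta>"
  proof
    assume "J \<in> fam \<delta>"
    then obtain k where "k \<in> K" "\<forall>j\<in>J. \<delta> \<le> k j" unfolding fam_def by blast
    then show False using J(3) assms by fastforce
  qed
  then show "\<exists>U\<subseteq>L. finite U \<and> U \<notin> fam \<delta>" using J by blast
qed

text \<open>Otherwise suppression yields a functional that is positive on the pieces of a bounded coefficient
  sequence and negligible off them, contradicting boundedness.\<close>

lemma not_always_supports_on:
  assumes cf: "compact_family \<S>" and N: "infinite N" and \<kappa>: "0 < \<kappa>"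
    and wit: "\<And>N'. N' \<subseteq> N \<Longrightarrow> infinite N' \<Longrightarrow> \<exists>a. bounded_coeffs N' a \<and>
      (\<forall>n \<epsilon>. 0 < \<epsilon> \<longrightarrow> (\<exists>B\<subseteq>N' \<inter> {n..}. piece \<S> B \<and> (\<forall>j\<in>B. 0 \<le> a j) \<and>
        \<kappa> \<le> sum a (body B) \<and> a (Min B) \<le> \<epsilon>))"
  shows "\<exists>L\<subseteq>N. infinite L \<and> (\<forall>n. \<forall>k\<in>K. \<not> supports_on \<S> (4 / \<kappa>) (L \<inter> {..<n}) k)"
proof (rule ccontr)
  assume contr: "\<not> ?thesis"
  define \<G> where "\<G> = {H. \<exists>k\<in>K. supports_on \<S> (4 / \<kappa>) H k}"
  have ex: "\<exists>n. L \<inter> {..<n} \<in> \<G>" if "L \<subseteq> N" "infinite L" for L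
    using contr that unfolding \<G>_def by blast
  \<comment> \<open>Suppression requires a thin family, so only those members of \<G> are kept that
    have no proper initial segment in \<G>.\<close>
  define \<B> where "\<B> = {H\<in>\<G>. \<forall>n. H \<inter> {..<n} \<in> \<G> \<longrightarrow> H \<inter> {..<n} = H}"
  have fin: "finite H" if "H \<in> \<B>" for H using that supports_on_finite unfolding \<B>_def \<G>_def by blast
  have "\<exists>N'\<subseteq>N. infinite N' \<and> (\<forall>H\<in>\<B>. H \<subseteq> N' \<longrightarrow>
      (\<forall>b. \<exists>k\<in>K. supports_on \<S> (4 / \<kappa>) H k \<and> (\<Sum>j\<in>(N' - H) \<inter> {..<b}. \<bar>k j\<bar>) \<le> 1))"
  proof (rule suppress[OF N fin])
    fix H H' assume H: "H \<in> \<B>" "H' \<in> \<B>" "H \<subseteq> H'" "\<forall>i\<in>H. \<forall>j\<in>H' - H. i < j"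
    have "\<exists>n. H = H' \<inter> {..<n}"
    proof (cases "H = {}")
      case True then show ?thesis by auto
    next
      case False
      have "H = H' \<inter> {..<Suc (Max H)}"
        using H(3,4) Max_in[OF fin[OF H(1)] False] Max_ge[OF fin[OF H(1)]]
        by (auto simp: less_Suc_eq_le) (metis DiffI leD)
      then show ?thesis by blast
    qed
    then show "H = H'" using H(1,2) unfolding \<B>_def by auto
  next
    fix H assume "H \<in> \<B>"
    then show "\<exists>k\<in>K. supports_on \<S> (4 / \<kappa>) H k" unfolding \<B>_def \<G>_def by blast
  qed
  then obtain N' where N': "N' \<subseteq> N" "infinite N'"
    "\<forall>H\<in>\<B>. H \<subseteq> N' \<longrightarrow> (\<forall>b. \<exists>k\<in>K. supports_on \<S> (4 / \<kappa>) H k \<and> (\<Sum>j\<in>(N' - H) \<inter> {..<b}. \<bar>k j\<bar>) \<le> 1)"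
    by (elim exE conjE)
  obtain a where a: "bounded_coeffs N' a" "\<And>n \<epsilon>. 0 < \<epsilon> \<Longrightarrow> \<exists>B\<subseteq>N' \<inter> {n..}. piece \<S> B \<and>
      (\<forall>j\<in>B. 0 \<le> a j) \<and> \<kappa> \<le> sum a (body B) \<and> a (Min B) \<le> \<epsilon>"
    using wit[OF N'(1,2)] by blast
  \<comment> \<open>The entry at the marker of the \<open>i\<close>-th piece is at most
    \<open>(1/2)^Suc i\<close>, so all markers together cost at most 1.\<close>
  define X where "X i B \<longleftrightarrow> B \<subseteq> N' \<and> piece \<S> B \<and> (\<forall>j\<in>B. 0 \<le> a j) \<and>
      \<kappa> \<le> sum a (body B) \<and> a (Min B) \<le> (1/2)^Suc i" for i :: nat and B
  have X: "\<exists>B. X i B \<and> B \<subseteq> {n..}" for i n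
    using a(2)[of "(1/2)^Suc i" n] unfolding X_def by auto
  have "\<exists>Bs. \<forall>i. X i (Bs i) \<and> Bs (Suc i) \<subseteq> {Suc (Max (Bs i))..}"
    by (rule dependent_nat_choice) (use X in blast)+
  then obtain Bs where Bs: "\<And>i. X i (Bs i)" "\<And>i. Bs (Suc i) \<subseteq> {Suc (Max (Bs i))..}" by blast
  have pc: "piece \<S> (Bs i)" for i using Bs(1)[of i] unfolding X_def by blast
  then have fB: "finite (Bs i)" "Bs i \<noteq> {}" for i unfolding piece_def by auto
  have max_less: "Max (Bs i) < Max (Bs (Suc i))" for i
    using subsetD[OF Bs(2) Max_in[OF fB]] by (simp add: Suc_le_eq)
  have less: "x < y" if "i < j" "x \<in> Bs i" "y \<in> Bs j" for i j x y
  proof -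
    obtain p where p: "j = Suc p" "i \<le> p" using \<open>i < j\<close> less_imp_Suc_add[of i j] by auto
    have "Max (Bs i) \<le> Max (Bs p)"
      by (rule lift_Suc_mono_le[OF _ p(2)]) (use max_less in \<open>simp add: less_imp_le\<close>)
    moreover have "x \<le> Max (Bs i)" using fB that(2) by simp
    moreover have "Max (Bs p) < y" using subsetD[OF Bs(2)] that(3) p(1) by (simp add: Suc_le_eq)
    ultimately show ?thesis by simp
  qed
  define L where "L = (\<Union>i. Bs i)"
  have "L \<subseteq> N'" using Bs(1) unfolding L_def X_def by blast
  have "infinite L"
  proof
    assume "finite L"
    moreover have "Max (Bs i) \<in> L" for i using Max_in[OF fB] unfolding L_def by blast
    moreover have "strict_mono (\<lambda>i. Max (Bs i))" using max_less by (simp add: strict_mono_Suc_iff)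
    ultimately show False
      by (meson finite_subset image_subset_iff range_inj_infinite strict_mono_imp_inj_on)
  qed
  \<comment> \<open>Cutting \<open>L\<close> at the first possible place makes \<open>H\<close>
    minimal, so the functional from the suppression step is available for it.\<close>
  define b where "b = (LEAST n. L \<inter> {..<n} \<in> \<G>)"
  define H where "H = L \<inter> {..<b}"
  have "H \<in> \<G>"
    unfolding H_def b_def using ex[of L] \<open>L \<subseteq> N'\<close> N'(1) \<open>infinite L\<close> by (metis (no_types, lifting) LeastI order_trans)
  moreover have "H \<inter> {..<n} = H" if "H \<inter> {..<n} \<in> \<G>" for n
  proof (cases "b \<le> n")
    case True then show ?thesis unfolding H_def by auto
  next
    case False
    then have "H \<inter> {..<n} = L \<inter> {..<n}" unfolding H_def by auto
    then show ?thesis using that not_less_Least[of n "\<lambda>n. L \<inter> {..<n} \<in> \<G>"] False unfolding b_def by auto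
  qed
  ultimately have "H \<in> \<B>" unfolding \<B>_def by blast
  moreover have "H \<subseteq> N'" using \<open>L \<subseteq> N'\<close> unfolding H_def by blast
  ultimately obtain k where k: "k \<in> K" "supports_on \<S> (4 / \<kappa>) H k" "(\<Sum>j\<in>(N' - H) \<inter> {..<b}. \<bar>k j\<bar>) \<le> 1"
    using N'(3) by blast
  from k(2) obtain n :: nat and Bs' t where Bs': "\<And>i. i < n \<Longrightarrow> piece \<S> (Bs' i)"
    "\<And>i j x y. i < j \<Longrightarrow> j < n \<Longrightarrow> x \<in> Bs' i \<Longrightarrow> y \<in> Bs' j \<Longrightarrow> x < y" "H = (\<Union>i<n. Bs' i)"
    and t: "\<And>i. i < n \<Longrightarrow> 0 \<le> t i" "\<And>i j. i < n \<Longrightarrow> j \<in> body (Bs' i) \<Longrightarrow> t i \<le> k j"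
      "4 / \<kappa> \<le> (\<Sum>i<n. t i)"
    by (rule supports_onE) (rule that)
  have same: "Bs' i = Bs i" if "i < n" for i
  proof (rule run_unique[OF cf pc less Bs'(1,2) _ that])
    show "(\<Union>i<n. Bs' i) = (\<Union>i. Bs i) \<inter> {..<b}" using Bs'(3) unfolding H_def L_def by simp
  qed
  have block_ge: "t i * \<kappa> - (1/2)^Suc i \<le> (\<Sum>j\<in>Bs i. a j * k j)" if i: "i < n" for i
  proof -
    have XB: "\<forall>j\<in>Bs i. 0 \<le> a j" "\<kappa> \<le> sum a (body (Bs i))" "a (Min (Bs i)) \<le> (1/2)^Suc i"
      using Bs(1)[of i] unfolding X_def by auto
    have Min: "Min (Bs i) \<in> Bs i" using fB by simp
    have "t i * \<kappa> \<le> t i * sum a (body (Bs i))" using XB(2) t(1)[OF i] by (rule mult_left_mono)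
    also have "\<dots> = (\<Sum>j\<in>body (Bs i). a j * t i)" by (simp add: sum_distrib_left mult.commute)
    also have "\<dots> \<le> (\<Sum>j\<in>body (Bs i). a j * k j)"
      using t(2)[OF i] XB(1) same[OF i] by (intro sum_mono mult_left_mono) (auto simp: body_def)
    finally have 1: "t i * \<kappa> \<le> (\<Sum>j\<in>body (Bs i). a j * k j)" .
    have "a (Min (Bs i)) * - k (Min (Bs i)) \<le> a (Min (Bs i)) * 1"
      using XB(1) Min abs_le_1[OF k(1), of "Min (Bs i)"] by (intro mult_left_mono) auto
    then have 2: "- ((1/2)^Suc i) \<le> a (Min (Bs i)) * k (Min (Bs i))" using XB(3) by simp
    have "(\<Sum>j\<in>Bs i. a j * k j) = a (Min (Bs i)) * k (Min (Bs i)) + (\<Sum>j\<in>body (Bs i). a j * k j)"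
      unfolding body_def by (rule sum.remove[OF fB(1) Min])
    then show ?thesis using 1 2 by simp
  qed
  have "(\<Sum>i<m. (1/2)^Suc i) = (1 - (1/2)^m :: real)" for m by (induction m) auto
  then have half: "(\<Sum>i<n. (1/2)^Suc i) \<le> (1::real)" by simp
  \<comment> \<open>Of the 4 units seen on the pieces at most 1 is lost at the markers. The
    coordinates off \<open>H\<close> take at most 1 more, and the remaining 2 exceed the bound 1 for
    partial sums; this is the origin of the threshold \<open>4 / \<kappa>\<close>.\<close>
  have "4 - 1 \<le> (\<Sum>i<n. t i) * \<kappa> - (\<Sum>i<n. (1/2)^Suc i)"
    using mult_right_mono[OF t(3), of \<kappa>] \<kappa> half by simp
  also have "\<dots> = (\<Sum>i<n. t i * \<kappa> - (1/2)^Suc i)" by (simp add: sum_subtractf sum_distrib_right)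
  also have "\<dots> \<le> (\<Sum>i<n. \<Sum>j\<in>Bs i. a j * k j)" using block_ge by (intro sum_mono) simp
  also have "\<dots> = (\<Sum>j\<in>(\<Union>i<n. Bs i). a j * k j)"
  proof (rule sum.UNION_disjoint[symmetric])
    show "\<forall>i\<in>{..<n}. \<forall>j\<in>{..<n}. i \<noteq> j \<longrightarrow> Bs i \<inter> Bs j = {}"
      using less by (metis disjoint_iff linorder_neqE_nat less_irrefl)
  qed (use fB in auto)
  also have "(\<Union>i<n. Bs i) = H" using Bs'(3) same by auto
  finally have 3: "3 \<le> (\<Sum>j\<in>H. a j * k j)" by simp
  have "(\<Sum>j<b. a j * k j) = (\<Sum>j\<in>N' \<inter> {..<b}. a j * k j)"
    using a(1) unfolding bounded_coeffs_def by (intro sum.mono_neutral_right) auto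
  also have "N' \<inter> {..<b} = H \<union> (N' - H) \<inter> {..<b}" using \<open>H \<subseteq> N'\<close> unfolding H_def by auto
  also have "(\<Sum>j\<in>\<dots>. a j * k j) = (\<Sum>j\<in>H. a j * k j) + (\<Sum>j\<in>(N' - H) \<inter> {..<b}. a j * k j)"
    by (rule sum.union_disjoint) (auto simp: H_def)
  finally have 4: "(\<Sum>j<b. a j * k j) = (\<Sum>j\<in>H. a j * k j) + (\<Sum>j\<in>(N' - H) \<inter> {..<b}. a j * k j)" .
  have "\<bar>\<Sum>j\<in>(N' - H) \<inter> {..<b}. a j * k j\<bar> \<le> (\<Sum>j\<in>(N' - H) \<inter> {..<b}. \<bar>a j\<bar> * \<bar>k j\<bar>)"
    by (metis (no_types, lifting) abs_mult sum.cong sum_abs)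
  also have "\<dots> \<le> (\<Sum>j\<in>(N' - H) \<inter> {..<b}. 1 * \<bar>k j\<bar>)"
    using a(1) unfolding bounded_coeffs_def by (intro sum_mono mult_right_mono) auto
  finally have "\<bar>\<Sum>j\<in>(N' - H) \<inter> {..<b}. a j * k j\<bar> \<le> 1" using k(3) by simp
  moreover have "\<bar>\<Sum>j<b. a j * k j\<bar> \<le> 1" using a(1) k(1) unfolding bounded_coeffs_def by blast
  ultimately show False using 3 4 by linarith
qed

end

section \<open>Spread-out measures\<close>

text \<open>Take for \<open>t\<close> the largest value of \<open>f\<close> whose superlevel set
  still has mass at least \<open>\<eta>\<close>. The set where \<open>f\<close> exceeds
  \<open>t\<close> then has mass at most \<open>\<eta>\<close>; on it \<open>f\<close> is at most 1,
  and elsewhere at most \<open>t\<close>.\<close>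

lemma level_set:
  fixes f \<nu> :: "nat \<Rightarrow> real"
  assumes D: "finite D" and \<nu>: "\<And>j. 0 \<le> \<nu> j" "sum \<nu> D = 1"
    and f: "\<And>j. j \<in> D \<Longrightarrow> 0 \<le> f j" "\<And>j. j \<in> D \<Longrightarrow> f j \<le> 1" and \<eta>: "0 < \<eta>" "\<eta> \<le> 1"
  obtains t where "0 \<le> t" "\<eta> \<le> sum \<nu> {j\<in>D. t \<le> f j}" "(\<Sum>j\<in>D. \<nu> j * f j) \<le> t + \<eta>"
proof -
  have "D \<noteq> {}" using \<nu>(2) by auto
  define V where "V = {v \<in> f ` D. \<eta> \<le> sum \<nu> {j\<in>D. v \<le> f j}}"
  have "finite V" using D unfolding V_def by simp
  have "Min (f ` D) \<in> V"
  proof -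
    have "{j\<in>D. Min (f ` D) \<le> f j} = D" using D by auto
    then show ?thesis using D \<open>D \<noteq> {}\<close> \<nu>(2) \<eta>(2) unfolding V_def by simp
  qed
  define t where "t = Max V"
  have t: "t \<in> V" unfolding t_def using \<open>finite V\<close> \<open>Min (f ` D) \<in> V\<close> Max_in by blast
  let ?U = "{j\<in>D. t < f j}"
  have "sum \<nu> ?U \<le> \<eta>"
  proof (cases "?U = {}")
    case True
    show ?thesis unfolding True using \<eta>(1) by simp
  next
    case False
    define v where "v = Min (f ` ?U)"
    have v: "v \<in> f ` ?U" unfolding v_def using D False by (intro Min_in) auto
    have "{j\<in>D. v \<le> f j} = ?U"
    proof
      show "{j\<in>D. v \<le> f j} \<subseteq> ?U" using v by auto
      show "?U \<subseteq> {j\<in>D. v \<le> f j}" unfolding v_def using D by auto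
    qed
    moreover have "v \<notin> V"
    proof
      assume "v \<in> V"
      then have "v \<le> t" unfolding t_def using \<open>finite V\<close> by simp
      then show False using v by auto
    qed
    moreover have "v \<in> f ` D" using v by auto
    ultimately show ?thesis unfolding V_def by simp
  qed
  moreover have "(\<Sum>j\<in>D. \<nu> j * f j) \<le> (\<Sum>j\<in>D. t * \<nu> j + (if j \<in> ?U then \<nu> j else 0))"
  proof (rule sum_mono)
    fix j assume "j \<in> D"
    have "0 \<le> t" using t f unfolding V_def by auto
    show "\<nu> j * f j \<le> t * \<nu> j + (if j \<in> ?U then \<nu> j else 0)"
    proof (cases "t < f j")
      case True
      have "\<nu> j * f j \<le> \<nu> j * 1" using f(2)[OF \<open>j \<in> D\<close>] \<nu>(1) by (intro mult_left_mono) auto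
      moreover have "0 \<le> t * \<nu> j" using \<open>0 \<le> t\<close> \<nu>(1) by simp
      ultimately show ?thesis using True \<open>j \<in> D\<close> by simp
    next
      case False
      then have "f j * \<nu> j \<le> t * \<nu> j" using \<nu>(1) by (intro mult_right_mono) auto
      then show ?thesis using False by (simp add: mult.commute)
    qed
  qed
  moreover have "(\<Sum>j\<in>D. t * \<nu> j + (if j \<in> ?U then \<nu> j else 0)) = t + sum \<nu> ?U"
    using D \<nu>(2) by (simp add: sum.distrib sum_distrib_left[symmetric] sum.inter_filter)
  ultimately have "(\<Sum>j\<in>D. \<nu> j * f j) \<le> t + \<eta>" by linarith
  moreover have "0 \<le> t" using t f unfolding V_def by auto
  moreover have "\<eta> \<le> sum \<nu> {j\<in>D. t \<le> f j}" using t unfolding V_def by simp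
  ultimately show ?thesis using that by blast
qed

context coefficient_set
begin

text \<open>The blocks are the barycentres of the measures \<open>\<nu> i\<close>. Membership of
  \<open>D i\<close> in \<open>fam \<delta>\<close> bounds their norms from below, and the uniform
  bound on the absolute sums is the dual form of the upper estimate in
  \<open>c\<^sub>0\<close>.\<close>

definition c0_blocks :: "real \<Rightarrow> nat set \<Rightarrow> bool" where
  "c0_blocks \<delta> M \<longleftrightarrow> (\<exists>D \<nu> C. (\<forall>i. D i \<subseteq> M \<and> D i \<in> fam \<delta> \<and> (\<forall>j. 0 \<le> \<nu> i j) \<and>
      sum (\<nu> i) (D i) = 1 \<and> Max (D i) < Min (D (Suc i))) \<and>
    (\<forall>k\<in>K. \<forall>n. (\<Sum>i<n. \<bar>\<Sum>j\<in>D i. \<nu> i j * k j\<bar>) \<le> C))"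

lemma c0_blocks_mono:
  assumes "c0_blocks \<delta> M" "M \<subseteq> N" shows "c0_blocks \<delta> N"
proof -
  from assms(1) obtain D \<nu> C where *: "\<forall>i. D i \<subseteq> M \<and> D i \<in> fam \<delta> \<and> (\<forall>j. 0 \<le> \<nu> i j) \<and>
      sum (\<nu> i) (D i) = 1 \<and> Max (D i) < Min (D (Suc i))"
    "\<forall>k\<in>K. \<forall>n. (\<Sum>i<n. \<bar>\<Sum>j\<in>D i. \<nu> i j * k j\<bar>) \<le> C"
    unfolding c0_blocks_def by (elim exE conjE) (rule that)
  show ?thesis
    unfolding c0_blocks_def
    by (rule exI[of _ D], rule exI[of _ \<nu>], rule exI[of _ C]) (use * assms(2) in blast)
qed

text \<open>The measures \<open>\<nu>\<close> are so spread out that every set of non-negligible measure contains the body of a piece.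
  Replacing \<open>k\<close> by its level on such a set bounds the sum of the integrals of \<open>k\<close>.\<close>

lemma c0_blocksI:
  assumes cf: "compact_family \<S>" and M: "infinite M" and sing: "\<And>l. l \<in> M \<Longrightarrow> {l} \<in> \<S>" and \<kappa>: "0 < \<kappa>"
    and wit: "\<And>N. N \<subseteq> M \<Longrightarrow> infinite N \<Longrightarrow> \<exists>a. bounded_coeffs N a \<and>
      (\<forall>n \<epsilon>. 0 < \<epsilon> \<longrightarrow> (\<exists>B\<subseteq>N \<inter> {n..}. piece \<S> B \<and> (\<forall>j\<in>B. 0 \<le> a j) \<and>
        \<kappa> \<le> sum a (body B) \<and> a (Min B) \<le> \<epsilon>))"
    and room: "\<And>N l n \<eta>. N \<subseteq> M \<Longrightarrow> infinite N \<Longrightarrow> l \<in> N \<Longrightarrow> 0 < \<eta> \<Longrightarrow> \<exists>D\<subseteq>N \<inter> {n..}. D \<in> fam \<delta> \<and>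
      (\<exists>\<nu>::nat \<Rightarrow> real. (\<forall>j. 0 \<le> \<nu> j) \<and> sum \<nu> D = 1 \<and> (\<forall>T\<subseteq>D. T \<in> shift \<S> l \<longrightarrow> sum \<nu> T < \<eta>))"
  shows "c0_blocks \<delta> M"
proof -
  define \<G> where "\<G> = {H. \<exists>k\<in>K. supports_on \<S> (4 / \<kappa>) H k}"
  obtain N where N: "N \<subseteq> M" "infinite N" and
    alt: "(\<forall>L\<subseteq>N. infinite L \<longrightarrow> (\<exists>n. L \<inter> {..<n} \<in> \<G>)) \<or> (\<forall>s\<subseteq>N. finite s \<longrightarrow> s \<notin> \<G>)"
    using Galvin[OF M, of \<G>] by blast
  have "\<exists>L\<subseteq>N. infinite L \<and> (\<forall>n. \<forall>k\<in>K. \<not> supports_on \<S> (4 / \<kappa>) (L \<inter> {..<n}) k)"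
    by (rule not_always_supports_on[OF cf N(2) \<kappa>], rule wit[OF order_trans[OF _ N(1)]])
  \<comment> \<open>The set \<open>L\<close> just found violates the first alternative of
    \<open>Galvin\<close>, so the second one holds.\<close>
  then have none: "s \<notin> \<G>" if "s \<subseteq> N" "finite s" for s using alt that unfolding \<G>_def by blast
  define X where "X i Y \<longleftrightarrow> (case Y of (l, D, \<nu>) \<Rightarrow> l \<in> N \<and> D \<subseteq> N \<inter> {Suc l..} \<and> D \<in> fam \<delta> \<and>
      (\<forall>j. 0 \<le> \<nu> j) \<and> sum \<nu> D = 1 \<and> (\<forall>T\<subseteq>D. T \<in> shift \<S> l \<longrightarrow> sum \<nu> T < (1/2)^i))"
    for i :: nat and Y :: "nat \<times> nat set \<times> (nat \<Rightarrow> real)"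
  have X: "\<exists>Y. X i Y \<and> b < fst Y" for i b
  proof -
    obtain l where l: "l \<in> N" "b < l" using N(2) by (meson infinite_nat_iff_unbounded)
    then obtain D and \<nu> :: "nat \<Rightarrow> real" where "D \<subseteq> N \<inter> {Suc l..}" "D \<in> fam \<delta>" "\<forall>j. 0 \<le> \<nu> j" "sum \<nu> D = 1"
      "\<forall>T\<subseteq>D. T \<in> shift \<S> l \<longrightarrow> sum \<nu> T < (1/2)^i"
      using room[OF N l(1), of "(1/2)^i" "Suc l"] by auto
    then have "X i (l, D, \<nu>)" using l unfolding X_def by simp
    then show ?thesis using l by auto
  qed
  have "\<exists>Y. \<forall>i. X i (Y i) \<and> Max (fst (snd (Y i))) < fst (Y (Suc i))"
    by (rule dependent_nat_choice) (use X in blast)+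
  then obtain Y where Y: "\<And>i. X i (Y i)" "\<And>i. Max (fst (snd (Y i))) < fst (Y (Suc i))" by blast
  define l D \<nu> where "l i = fst (Y i)" and "D i = fst (snd (Y i))" and "\<nu> i = snd (snd (Y i))" for i
  have lD: "l i \<in> N" "D i \<subseteq> N" "\<And>j. j \<in> D i \<Longrightarrow> l i < j" "D i \<in> fam \<delta>" "\<And>j. 0 \<le> \<nu> i j"
    "sum (\<nu> i) (D i) = 1" "\<And>T. T \<subseteq> D i \<Longrightarrow> T \<in> shift \<S> (l i) \<Longrightarrow> sum (\<nu> i) T < (1/2)^i" for i
    using Y(1)[of i] unfolding X_def l_def D_def \<nu>_def by (auto split: prod.splits simp: Suc_le_eq)
  have fD: "finite (D i)" "D i \<noteq> {}" for i using lD(4,6)[of i] unfolding fam_def by auto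
  have next_l: "Max (D i) < l (Suc i)" for i using Y(2) unfolding D_def l_def .
  have D_l: "x < l j" if "i < j" "x \<in> D i" for i j x
  proof -
    obtain p where p: "j = Suc p" "i \<le> p" using \<open>i < j\<close> less_imp_Suc_add[of i j] by auto
    have "Max (D i) \<le> Max (D p)"
    proof (rule lift_Suc_mono_le[OF _ p(2)])
      show "Max (D n) \<le> Max (D (Suc n))" for n
        using next_l[of n] lD(3)[OF Max_in[OF fD]] by (meson less_imp_le less_trans)
    qed
    then show ?thesis using Max_ge[OF fD(1) \<open>x \<in> D i\<close>] next_l[of p] p(1) by simp
  qed
  have half: "(\<Sum>i<n. (1/2)^i) \<le> (2::real)" for n
  proof -
    have "(\<Sum>i<m. (1/2)^i) = (2 - 2 * (1/2)^m :: real)" for m by (induction m) auto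
    then show ?thesis by simp
  qed
  \<comment> \<open>Only positive parts are integrated here; negative parts are reached by applying
    this to the negated functional. The summand 2 collects the tolerances
    \<open>(1/2)^i\<close>.\<close>
  have pos: "(\<Sum>i<n. \<Sum>j\<in>D i. \<nu> i j * max (k j) 0) \<le> 4 / \<kappa> + 2" if k: "k \<in> K" for k n
  proof -
    let ?f = "\<lambda>j. max (k j) 0"
    have "\<exists>t. 0 \<le> t \<and> (1/2)^i \<le> sum (\<nu> i) {j\<in>D i. t \<le> ?f j} \<and> (\<Sum>j\<in>D i. \<nu> i j * ?f j) \<le> t + (1/2)^i" for i
    proof -
      have f: "?f j \<le> 1" for j using abs_le_1[OF k, of j] by simp
      show ?thesis
      proof (rule level_set[where f = ?f and \<eta> = "(1/2)^i" and \<nu> = "\<nu> i" and D = "D i"])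
        show "(1/2)^i \<le> (1::real)" by (simp add: power_le_one)
      qed (use fD lD(5,6) f in auto)
    qed
    then have "\<exists>t. \<forall>i. 0 \<le> t i \<and> (1/2)^i \<le> sum (\<nu> i) {j\<in>D i. t i \<le> ?f j} \<and>
        (\<Sum>j\<in>D i. \<nu> i j * ?f j) \<le> t i + (1/2)^i"
      by (intro choice allI)
    then obtain t where t': "\<forall>i. 0 \<le> t i \<and> (1/2)^i \<le> sum (\<nu> i) {j\<in>D i. t i \<le> ?f j} \<and>
        (\<Sum>j\<in>D i. \<nu> i j * ?f j) \<le> t i + (1/2)^i" ..
    then have t: "0 \<le> t i" "(1/2)^i \<le> sum (\<nu> i) {j\<in>D i. t i \<le> ?f j}"
      "(\<Sum>j\<in>D i. \<nu> i j * ?f j) \<le> t i + (1/2)^i" for i by simp_all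
    have "\<exists>B. piece \<S> B \<and> l i \<in> B \<and> B \<subseteq> insert (l i) {j\<in>D i. t i \<le> ?f j}" for i
    proof -
      let ?T = "{j\<in>D i. t i \<le> ?f j}"
      \<comment> \<open>The level set is too heavy for the shifted family, so together with
        \<open>l i\<close> it leaves \<S>, and its first piece starts at the marker
        \<open>l i\<close>.\<close>
      have "?T \<notin> shift \<S> (l i)" using lD(7)[of ?T i] t(2)[of i] by auto
      then have notS: "insert (l i) ?T \<notin> \<S>" using lD(3) unfolding shift_def by auto
      define m where "m = Suc (Max (insert (l i) ?T))"
      have "insert (l i) ?T \<inter> {..<m} = insert (l i) ?T"
        using fD(1)[of i] unfolding m_def by (auto simp: less_Suc_eq_le)
      then obtain p where p: "piece \<S> (insert (l i) ?T \<inter> {..<p})"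
        using initial_piece[OF _ compact_familyD(1)[OF cf], of "insert (l i) ?T" m] notS by metis
      then obtain x where "x \<in> insert (l i) ?T" "x < p" unfolding piece_def by auto
      then have "l i < p" using lD(3)[of x i] by auto
      then show ?thesis using p by (intro exI[of _ "insert (l i) ?T \<inter> {..<p}"]) auto
    qed
    then have "\<exists>B. \<forall>i. piece \<S> (B i) \<and> l i \<in> B i \<and> B i \<subseteq> insert (l i) {j\<in>D i. t i \<le> ?f j}"
      by (intro choice allI)
    then obtain B where B': "\<forall>i. piece \<S> (B i) \<and> l i \<in> B i \<and> B i \<subseteq> insert (l i) {j\<in>D i. t i \<le> ?f j}" ..
    then have B: "piece \<S> (B i)" "l i \<in> B i" "B i \<subseteq> insert (l i) {j\<in>D i. t i \<le> ?f j}" for i by simp_all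
    have fB: "finite (B i)" for i using B(1) unfolding piece_def by blast
    have Min_B: "Min (B i) = l i" for i
      using fB B(2,3)[of i] lD(3)[of _ i] by (intro Min_eqI) (auto dest!: less_imp_le)
    have B_less: "x < y" if "i < j" "x \<in> B i" "y \<in> B j" for i j x y
    proof -
      have "x = l i \<or> x \<in> D i" "y = l j \<or> y \<in> D j" using B(3)[of i] B(3)[of j] that by auto
      then have "x \<le> Max (D i)" using Max_ge[OF fD(1)] lD(3)[OF Max_in[OF fD], of i] by auto
      also have "Max (D i) < l j" using D_l[OF that(1) Max_in[OF fD]] .
      also have "l j \<le> y" using \<open>y = l j \<or> y \<in> D j\<close> lD(3)[of y j] by auto
      finally show ?thesis .
    qed
    have "(\<Sum>i<n. t i) \<le> 4 / \<kappa>"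
    proof (rule ccontr)
      assume big: "\<not> (\<Sum>i<n. t i) \<le> 4 / \<kappa>"
      \<comment> \<open>Indices with \<open>t i = 0\<close> are discarded: for them the level of the
        positive part gives no lower bound on \<open>k\<close> itself.\<close>
      define I where "I = {i. i < n \<and> 0 < t i}"
      have "finite I" unfolding I_def by simp
      then obtain h where h: "bij_betw h {..<card I} I" "strict_mono_on {..<card I} h"
        by (rule ex_bij_betw_strict_mono_card)
      have "(\<Sum>i<n. t i) = (\<Sum>i\<in>I. t i)"
        using t(1) unfolding I_def by (intro sum.mono_neutral_right) (auto simp: less_le)
      also have "\<dots> = (\<Sum>i<card I. t (h i))" by (rule sum.reindex_bij_betw[OF h(1), symmetric])
      finally have sum: "4 / \<kappa> \<le> (\<Sum>i<card I. t (h i))" using big by simp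
      have "supports_on \<S> (4 / \<kappa>) (\<Union>i<card I. B (h i)) k"
        unfolding supports_on_def
      proof (intro exI conjI allI impI)
        fix i j x y assume "i < j" "j < card I" "x \<in> B (h i)" "y \<in> B (h j)"
        moreover from this have "h i < h j" using h(2) unfolding strict_mono_on_def by auto
        ultimately show "x < y" using B_less by blast
      next
        fix i assume "i < card I"
        then have "h i \<in> I" using h(1) bij_betwE by blast
        then have "0 < t (h i)" unfolding I_def by simp
        moreover have "body (B (h i)) \<subseteq> {j\<in>D (h i). t (h i) \<le> ?f j}"
          using B(3)[of "h i"] Min_B[of "h i"] unfolding body_def by auto
        ultimately show "\<forall>j\<in>body (B (h i)). t (h i) \<le> k j" by fastforce
      qed (use B(1) t(1) sum in auto)
      then have "(\<Union>i<card I. B (h i)) \<in> \<G>" using k unfolding \<G>_def by blast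
      moreover have "(\<Union>i<card I. B (h i)) \<subseteq> N" using B(3) lD(1,2) by blast
      ultimately show False using none fB by auto
    qed
    moreover have "(\<Sum>i<n. \<Sum>j\<in>D i. \<nu> i j * ?f j) \<le> (\<Sum>i<n. t i + (1/2)^i)" using t(3) by (rule sum_mono)
    ultimately show ?thesis using half[of n] by (simp add: sum.distrib)
  qed
  have "(\<Sum>i<n. \<bar>\<Sum>j\<in>D i. \<nu> i j * k j\<bar>) \<le> 2 * (4 / \<kappa> + 2)" if k: "k \<in> K" for k n
  proof -
    have "\<bar>\<Sum>j\<in>D i. \<nu> i j * k j\<bar> \<le> (\<Sum>j\<in>D i. \<nu> i j * max (k j) 0) + (\<Sum>j\<in>D i. \<nu> i j * max (- k j) 0)" for i
    proof -
      have "\<bar>\<Sum>j\<in>D i. \<nu> i j * k j\<bar> \<le> (\<Sum>j\<in>D i. \<bar>\<nu> i j * k j\<bar>)" by (rule sum_abs)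
      also have "\<dots> = (\<Sum>j\<in>D i. \<nu> i j * max (k j) 0 + \<nu> i j * max (- k j) 0)"
        using lD(5) by (intro sum.cong) (auto simp: abs_mult max_def)
      finally show ?thesis by (simp add: sum.distrib)
    qed
    then have "(\<Sum>i<n. \<bar>\<Sum>j\<in>D i. \<nu> i j * k j\<bar>)
      \<le> (\<Sum>i<n. (\<Sum>j\<in>D i. \<nu> i j * max (k j) 0) + (\<Sum>j\<in>D i. \<nu> i j * max (- k j) 0))"
      by (rule sum_mono)
    also have "\<dots> \<le> 2 * (4 / \<kappa> + 2)"
      using pos[OF k, of n] pos[OF uminus_mem[OF k], of n] by (simp add: sum.distrib)
    finally show ?thesis .
  qed
  moreover have "Max (D i) < Min (D (Suc i))" for i
    using next_l[of i] lD(3)[OF Min_in[OF fD], of "Suc i"] by simp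
  moreover have "D i \<subseteq> M" for i using lD(2) N(1) by blast
  ultimately show ?thesis using lD(4,5,6) unfolding c0_blocks_def by blast
qed

end

section \<open>Charged families\<close>

context coefficient_set
begin

definition witness :: "nat set set \<Rightarrow> real \<Rightarrow> nat set \<Rightarrow> (nat \<Rightarrow> real) \<Rightarrow> bool" where
  "witness \<S> \<kappa> L a \<longleftrightarrow> bounded_coeffs L a \<and>
    (\<forall>n. \<exists>T\<in>\<S>. T \<subseteq> L \<inter> {n..} \<and> (\<forall>j\<in>T. 0 \<le> a j) \<and> \<kappa> \<le> sum a T)"

text \<open>The constant is chosen before \<open>L\<close>. Hence failure means that for each
  \<kappa> > 0 some infinite subset carries no witness at all, which is the form that
  \<open>diagonal\<close> can exploit.\<close>

definition charged :: "nat set set \<Rightarrow> nat set \<Rightarrow> bool" where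
  "charged \<S> M \<longleftrightarrow> (\<exists>\<kappa>>0. \<forall>L\<subseteq>M. infinite L \<longrightarrow> (\<exists>a. witness \<S> \<kappa> L a))"

lemma bounded_coeffs_mono: "bounded_coeffs L a \<Longrightarrow> L \<subseteq> L' \<Longrightarrow> bounded_coeffs L' a"
  unfolding bounded_coeffs_def by blast

lemma witness_mono:
  assumes "witness \<S> \<kappa> L a" "\<S> \<subseteq> \<S>'" "\<kappa>' \<le> \<kappa>" "L \<subseteq> L'"
  shows "witness \<S>' \<kappa>' L' a"
  unfolding witness_def
proof (intro conjI allI)
  fix n
  obtain T where "T \<in> \<S>" "T \<subseteq> L \<inter> {n..}" "\<forall>j\<in>T. 0 \<le> a j" "\<kappa> \<le> sum a T"
    using assms(1) unfolding witness_def by blast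
  then show "\<exists>T\<in>\<S>'. T \<subseteq> L' \<inter> {n..} \<and> (\<forall>j\<in>T. 0 \<le> a j) \<and> \<kappa>' \<le> sum a T"
    using assms(2-4) by (intro bexI[of _ T]) auto
qed (use assms bounded_coeffs_mono in \<open>auto simp: witness_def\<close>)

text \<open>Partial sums of the truncated sequence are differences of two partial sums of
  \<open>a\<close>; halving restores the bound 1 at the price of half the mass.\<close>

lemma witness_tail:
  assumes "witness \<S> \<kappa> L a"
  shows "witness \<S> (\<kappa>/2) (L \<inter> {m..}) (\<lambda>j. if m \<le> j then a j / 2 else 0)"
proof -
  let ?b = "\<lambda>j. if m \<le> j then a j / 2 else 0"
  have a: "\<And>j. j \<notin> L \<Longrightarrow> a j = 0" "\<And>j. \<bar>a j\<bar> \<le> 1" "\<And>k n. k \<in> K \<Longrightarrow> \<bar>\<Sum>j<n. a j * k j\<bar> \<le> 1"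
    using assms unfolding witness_def bounded_coeffs_def by auto
  have "\<bar>\<Sum>j<n. ?b j * k j\<bar> \<le> 1" if k: "k \<in> K" for k n
  proof -
    have "(\<Sum>j<n. ?b j * k j) = (\<Sum>j\<in>{..<n} - {..<m}. a j * k j / 2)"
      by (rule sum.mono_neutral_cong_right) auto
    also have "\<dots> = (\<Sum>j\<in>{..<n} - {..<min m n}. a j * k j / 2)" by (rule sum.cong) auto
    also have "\<dots> = (\<Sum>j<n. a j * k j / 2) - (\<Sum>j<min m n. a j * k j / 2)" by (rule sum_diff) auto
    also have "\<dots> = ((\<Sum>j<n. a j * k j) - (\<Sum>j<min m n. a j * k j)) / 2"
      by (simp add: sum_divide_distrib diff_divide_distrib)
    finally show ?thesis using a(3)[OF k, of n] a(3)[OF k, of "min m n"] by (simp add: abs_le_iff)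
  qed
  moreover have "\<bar>?b j\<bar> \<le> 1" for j using a(2)[of j] by simp
  moreover have "\<exists>T\<in>\<S>. T \<subseteq> L \<inter> {m..} \<inter> {n..} \<and> (\<forall>j\<in>T. 0 \<le> ?b j) \<and> \<kappa>/2 \<le> sum ?b T" for n
  proof -
    obtain T where T: "T \<in> \<S>" "T \<subseteq> L \<inter> {max m n..}" "\<forall>j\<in>T. 0 \<le> a j" "\<kappa> \<le> sum a T"
      using assms unfolding witness_def by blast
    have "sum ?b T = (\<Sum>j\<in>T. a j / 2)" using T(2) by (intro sum.cong) auto
    also have "\<dots> = sum a T / 2" by (simp add: sum_divide_distrib)
    finally have "\<kappa>/2 \<le> sum ?b T" using T(4) by simp
    then show ?thesis using T by (intro bexI[of _ T]) auto
  qed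
  ultimately show ?thesis using a(1) unfolding witness_def bounded_coeffs_def by auto
qed

lemma fam_antimono: "\<delta> \<le> \<delta>' \<Longrightarrow> fam \<delta>' \<subseteq> fam \<delta>"
  unfolding fam_def by (auto intro: order_trans)

lemma inverse_Suc_le:
  assumes "0 < (c::real)" obtains n where "1 / Suc n \<le> c"
  using reals_Archimedean[OF assms] by (auto simp: inverse_eq_divide intro: less_imp_le)

text \<open>If no constant worked, every infinite set could be thinned, for each \<open>n\<close>,
  to one without a witness for the constant \<open>1 / Suc n\<close>. The diagonal set still has a
  witness with some \<delta> of its own, and a tail of it, with constant \<open>\<delta>/2\<close>,
  is forbidden by \<open>Q n\<close>.\<close>

lemma ex_uniform:
  assumes "\<And>L. infinite L \<Longrightarrow> \<exists>\<delta>>0. \<exists>a. witness (fam \<delta>) \<delta> L a"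
  shows "\<exists>M \<delta>. infinite M \<and> 0 < \<delta> \<and> \<delta> \<le> 1 \<and> charged (fam \<delta>) M"
proof (rule ccontr)
  assume contr: "\<not> ?thesis"
  define Q where "Q n L \<longleftrightarrow> (\<forall>a. \<not> witness (fam (1 / Suc n)) (1 / Suc n) L a)" for n L
  have "\<exists>L\<subseteq>N. infinite L \<and> Q n L" if "infinite N" for n N
  proof -
    have "\<not> charged (fam (1 / Suc n)) N" using contr that by auto
    then show ?thesis unfolding charged_def Q_def by (metis of_nat_0_less_iff zero_less_Suc zero_less_divide_1_iff)
  qed
  moreover have "Q n L" if "Q n N" "L \<subseteq> N" for n N L
    using that witness_mono[OF _ order_refl order_refl] unfolding Q_def by blast
  ultimately obtain L where L: "infinite L" "\<And>n. \<exists>m. Q n (L \<inter> {m..})"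
    using diagonal[of UNIV Q] infinite_UNIV_nat by (metis subset_UNIV)
  obtain \<delta> a where \<delta>: "0 < \<delta>" "witness (fam \<delta>) \<delta> L a" using assms[OF L(1)] by blast
  obtain n where n: "1 / Suc n \<le> \<delta> / 2" using inverse_Suc_le[of "\<delta>/2"] \<delta>(1) by auto
  obtain m where "Q n (L \<inter> {m..})" using L(2) by blast
  moreover have "1 / Suc n \<le> \<delta>" using n \<delta>(1) by simp
  ultimately show False
    using witness_mono[OF witness_tail[OF \<delta>(2)] fam_antimono n order_refl] unfolding Q_def by blast
qed

lemma shift_subset:
  assumes "compact_family \<S>" shows "shift \<S> l \<subseteq> \<S>"
  using compact_familyD(3)[OF assms] unfolding shift_def by blast

lemma compact_family_shift:
  assumes cf: "compact_family \<S>" and "{l} \<in> \<S>"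
  shows "compact_family (shift \<S> l)"
proof -
  have "{} \<in> shift \<S> l" using assms(2) unfolding shift_def by simp
  moreover have "finite T" if "T \<in> shift \<S> l" for T
    using that shift_subset[OF cf] compact_familyD(2)[OF cf] by blast
  moreover have "U \<in> shift \<S> l" if "T \<in> shift \<S> l" "U \<subseteq> T" for T U
  proof -
    have "insert l U \<subseteq> insert l T" using that(2) by blast
    then show ?thesis using that compact_familyD(3)[OF cf] unfolding shift_def by blast
  qed
  moreover have "\<exists>U\<subseteq>L. finite U \<and> U \<notin> shift \<S> l" if "infinite L" for L
    using cf that shift_subset[OF cf] unfolding compact_family_def by blast
  ultimately show ?thesis unfolding compact_family_def by blast
qed

lemma charged_mono: "charged \<S> M \<Longrightarrow> N \<subseteq> M \<Longrightarrow> charged \<S> N"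
  unfolding charged_def by (meson order_trans)

lemma charged_unbounded:
  assumes "charged \<S> M" "infinite M"
  shows "\<exists>T\<in>\<S>. T \<subseteq> M \<inter> {n..} \<and> T \<noteq> {}"
proof -
  obtain \<kappa> where \<kappa>: "0 < \<kappa>" "\<And>L. L \<subseteq> M \<Longrightarrow> infinite L \<Longrightarrow> \<exists>a. witness \<S> \<kappa> L a"
    using assms(1) unfolding charged_def by blast
  obtain a where "witness \<S> \<kappa> M a" using \<kappa>(2)[OF order_refl assms(2)] by blast
  then obtain T where T: "T \<in> \<S>" "T \<subseteq> M \<inter> {n..}" "\<kappa> \<le> sum a T" unfolding witness_def by blast
  then have "T \<noteq> {}" using \<kappa>(1) by auto
  then show ?thesis using T by blast
qed

text \<open>An infinite descent would produce an infinite set all of whose finite subsets belong to the compact family.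
  This replaces a minimality argument over the Cantor-Bendixson rank.\<close>

lemma minimal_charged:
  assumes cf: "compact_family \<S>0" and M0: "infinite M0" "charged \<S>0 M0"
  shows "\<exists>\<S> M. \<S> \<subseteq> \<S>0 \<and> compact_family \<S> \<and> M \<subseteq> M0 \<and> infinite M \<and> charged \<S> M \<and>
    (\<forall>l\<in>M. \<forall>N\<subseteq>M. infinite N \<longrightarrow> \<not> charged (shift \<S> l) N)"
proof (rule ccontr)
  assume contr: "\<not> ?thesis"
  define P where "P X \<longleftrightarrow> (case X of (\<S>, M) \<Rightarrow> \<S> \<subseteq> \<S>0 \<and> compact_family \<S> \<and> M \<subseteq> M0 \<and> infinite M \<and> charged \<S> M)" for X
  define R where "R X Y \<longleftrightarrow> (\<exists>l\<in>snd X. fst Y = shift (fst X) l \<and> snd Y \<subseteq> snd X \<inter> {l<..})"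
    for X Y :: "nat set set \<times> nat set"
  have "\<exists>f. \<forall>n. P (f n) \<and> R (f n) (f (Suc n))"
  proof (rule dependent_nat_choice)
    show "\<exists>X. P X" using cf M0 unfolding P_def by (intro exI[of _ "(\<S>0, M0)"]) auto
  next
    fix X and n :: nat assume "P X"
    then obtain \<S> M where X: "X = (\<S>, M)" "\<S> \<subseteq> \<S>0" "compact_family \<S>" "M \<subseteq> M0" "infinite M" "charged \<S> M"
      unfolding P_def by (cases X) auto
    then obtain l N where lN: "l \<in> M" "N \<subseteq> M" "infinite N" "charged (shift \<S> l) N"
      using contr by blast
    obtain T where "insert l T \<in> \<S>"
      using charged_unbounded[OF lN(4,3)] unfolding shift_def by blast
    then have "{l} \<in> \<S>" using compact_familyD(3)[OF X(3)] by blast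
    moreover have "charged (shift \<S> l) (N \<inter> {l<..})" by (rule charged_mono[OF lN(4)]) simp
    ultimately have "P (shift \<S> l, N \<inter> {l<..})"
      using X lN compact_family_shift shift_subset[OF X(3), of l] infinite_Int_greaterThan[OF lN(3)]
      unfolding P_def by auto
    moreover have "R X (shift \<S> l, N \<inter> {l<..})" using lN X(1) unfolding R_def by auto
    ultimately show "\<exists>Y. P Y \<and> R X Y" by blast
  qed
  then obtain f where f: "\<And>n. P (f n)" "\<And>n. R (f n) (f (Suc n))" by blast
  then have "\<forall>n. \<exists>l. l \<in> snd (f n) \<and> fst (f (Suc n)) = shift (fst (f n)) l \<and> snd (f (Suc n)) \<subseteq> snd (f n) \<inter> {l<..}"
    unfolding R_def by blast
  then have "\<exists>l. \<forall>n. l n \<in> snd (f n) \<and> fst (f (Suc n)) = shift (fst (f n)) (l n) \<and> snd (f (Suc n)) \<subseteq> snd (f n) \<inter> {l n<..}"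
    by (rule choice)
  then obtain l where "\<forall>n. l n \<in> snd (f n) \<and> fst (f (Suc n)) = shift (fst (f n)) (l n) \<and> snd (f (Suc n)) \<subseteq> snd (f n) \<inter> {l n<..}" ..
  then have l: "l n \<in> snd (f n)" "fst (f (Suc n)) = shift (fst (f n)) (l n)" "snd (f (Suc n)) \<subseteq> snd (f n) \<inter> {l n<..}" for n
    by simp_all
  have "l n < l (Suc n)" for n using subsetD[OF l(3) l(1)] by simp
  then have mono: "strict_mono l" by (simp add: strict_mono_Suc_iff)
  have \<S>f: "fst (f n) \<subseteq> \<S>0" "compact_family (fst (f n))" for n
    using f(1)[of n] unfolding P_def by (auto split: prod.splits)
  \<comment> \<open>Undoing the first \<open>n\<close> shifts puts the points \<open>l 0\<close>,
    ..., \<open>l (n - 1)\<close> back in front of \<open>T\<close>.\<close>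
  have init: "l ` {..<n} \<union> T \<in> \<S>0" if "T \<in> fst (f n)" for n T
    using that
  proof (induction n arbitrary: T)
    case 0 then show ?case using \<S>f(1) by auto
  next
    case (Suc n)
    then have "insert (l n) T \<in> fst (f n)" using l(2) unfolding shift_def by simp
    then have "l ` {..<n} \<union> insert (l n) T \<in> \<S>0" by (rule Suc.IH)
    then show ?case by (simp add: lessThan_Suc)
  qed
  have "infinite (range l)" by (intro range_inj_infinite strict_mono_imp_inj_on mono)
  then obtain U where U: "U \<subseteq> range l" "finite U" "U \<notin> \<S>0"
    using cf unfolding compact_family_def by blast
  then obtain I where I: "finite I" "U = l ` I" by (meson finite_subset_image)
  then obtain n where "I \<subseteq> {..<n}" by (meson finite_nat_iff_bounded)
  then have "U \<subseteq> l ` {..<n} \<union> {}" using I by blast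
  moreover have "l ` {..<n} \<union> {} \<in> \<S>0" using init compact_familyD(1)[OF \<S>f(2)] by blast
  ultimately show False using U(3) compact_familyD(3)[OF cf] by blast
qed

text \<open>A witness for this family with positive constant has entries bounded away from 0
  arbitrarily far out; being charged by it describes the case in which coefficients need not become
  small.\<close>

definition subsingletons :: "nat set set" where
  "subsingletons = {T. finite T \<and> card T \<le> 1}"

lemma infinite_split:
  assumes "infinite (N::nat set)"
  obtains N1 N2 where "N1 \<subseteq> N" "N2 \<subseteq> N" "infinite N1" "infinite N2" "N1 \<inter> N2 = {}"
proof (rule that)
  let ?e = "enumerate N"
  have mono: "strict_mono ?e" using assms by (rule strict_mono_enumerate)
  have "inj ?e" using mono by (rule strict_mono_imp_inj_on)
  show "range (\<lambda>n. ?e (2 * n)) \<subseteq> N" "range (\<lambda>n. ?e (2 * n + 1)) \<subseteq> N"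
    using assms by (auto simp: enumerate_in_set)
  show "infinite (range (\<lambda>n. ?e (2 * n)))" "infinite (range (\<lambda>n. ?e (2 * n + 1)))"
    by (auto intro!: range_inj_infinite injI simp: inj_eq[OF \<open>inj ?e\<close>])
  show "range (\<lambda>n. ?e (2 * n)) \<inter> range (\<lambda>n. ?e (2 * n + 1)) = {}"
  proof -
    have "2 * m \<noteq> 2 * n + 1" for m n :: nat by presburger
    then show ?thesis using inj_eq[OF \<open>inj ?e\<close>] by blast
  qed
qed

lemma compact_family_subsingletons: "compact_family subsingletons"
proof -
  have "\<exists>U\<subseteq>L. finite U \<and> U \<notin> subsingletons" if "infinite L" for L
  proof -
    obtain U where "U \<subseteq> L" "finite U" "card U = 2" using infinite_arbitrarily_large[of L 2] \<open>infinite L\<close> by blast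
    then show ?thesis unfolding subsingletons_def by auto
  qed
  moreover have "U \<in> subsingletons" if "T \<in> subsingletons" "U \<subseteq> T" for T U
    using that card_mono[of T U] unfolding subsingletons_def by (auto intro: finite_subset)
  moreover have "{} \<in> subsingletons" "\<And>T. T \<in> subsingletons \<Longrightarrow> finite T" by (auto simp: subsingletons_def)
  ultimately show ?thesis unfolding compact_family_def by blast
qed

lemma singleton_fam: "\<delta> \<le> 1 \<Longrightarrow> {j} \<in> fam \<delta>"
proof -
  assume "\<delta> \<le> 1"
  moreover obtain k where "k \<in> K" "k j = 1" using attains_1 by blast
  ultimately show ?thesis unfolding fam_def by (auto intro!: bexI[of _ k])
qed

text \<open>Pieces are pairs here. The coefficients are supported on one half of \<open>N\<close>
  and the markers are taken from the other half, where the entries vanish exactly. A shift of this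
  family contains only the empty set, so point masses are spread out as far as required.\<close>

lemma subsingletons_charged_case:
  assumes M: "infinite M" "charged subsingletons M" and \<delta>: "\<delta> \<le> 1"
  shows "c0_blocks \<delta> M"
proof -
  obtain \<kappa> where \<kappa>: "0 < \<kappa>" "\<And>L. L \<subseteq> M \<Longrightarrow> infinite L \<Longrightarrow> \<exists>a. witness subsingletons \<kappa> L a"
    using M(2) unfolding charged_def by blast
  show ?thesis
  proof (rule c0_blocksI[OF compact_family_subsingletons M(1) _ \<kappa>(1)])
    fix N assume N: "N \<subseteq> M" "infinite N"
    obtain N1 N2 where N12: "N1 \<subseteq> N" "N2 \<subseteq> N" "infinite N1" "infinite N2" "N1 \<inter> N2 = {}"
      using infinite_split[OF N(2)] .
    then obtain a where a: "witness subsingletons \<kappa> N1 a" using \<kappa>(2)[of N1] N by blast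
    have "\<exists>B\<subseteq>N \<inter> {n..}. piece subsingletons B \<and> (\<forall>j\<in>B. 0 \<le> a j) \<and> \<kappa> \<le> sum a (body B) \<and> a (Min B) \<le> \<epsilon>"
      if "0 < \<epsilon>" for n and \<epsilon> :: real
    proof -
      obtain l where l: "l \<in> N2" "n \<le> l" using N12(4) by (meson infinite_nat_iff_unbounded_le)
      obtain T where T: "T \<in> subsingletons" "T \<subseteq> N1 \<inter> {Suc l..}" "\<forall>j\<in>T. 0 \<le> a j" "\<kappa> \<le> sum a T"
        using a unfolding witness_def by blast
      then have "T \<noteq> {}" using \<kappa>(1) by auto
      then have "card T = 1" using T(1) card_gt_0_iff[of T] unfolding subsingletons_def by auto
      then obtain g where g: "T = {g}" by (rule card_1_singletonE)
      have "l < g" "g \<in> N1" using T(2) g by auto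
      have al: "a l = 0" using a l(1) N12(5) unfolding witness_def bounded_coeffs_def by auto
      have "Max {l, g} = g" "Min {l, g} = l" using \<open>l < g\<close> by auto
      moreover from this have "piece subsingletons {l, g}"
        using \<open>l < g\<close> unfolding piece_def subsingletons_def by (auto simp: insert_Diff_if)
      moreover have "body {l, g} = {g}" using \<open>l < g\<close> unfolding body_def by auto
      ultimately show ?thesis
        using l \<open>l < g\<close> \<open>g \<in> N1\<close> N12(1,2) T(3,4) g al that by (intro exI[of _ "{l, g}"]) auto
    qed
    moreover have "bounded_coeffs N a"
      using a N12(1) bounded_coeffs_mono unfolding witness_def by blast
    ultimately show "\<exists>a. bounded_coeffs N a \<and>
      (\<forall>n \<epsilon>. 0 < \<epsilon> \<longrightarrow> (\<exists>B\<subseteq>N \<inter> {n..}. piece subsingletons B \<and> (\<forall>j\<in>B. 0 \<le> a j) \<and> \<kappa> \<le> sum a (body B) \<and> a (Min B) \<le> \<epsilon>))"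
      by blast
  next
    fix N l n and \<eta> :: real assume N: "N \<subseteq> M" "infinite N" "l \<in> N" "0 < \<eta>"
    obtain j where j: "j \<in> N" "n \<le> j" using N(2) by (meson infinite_nat_iff_unbounded_le)
    define \<nu> :: "nat \<Rightarrow> real" where "\<nu> i = (if i = j then 1 else 0)" for i
    have "sum \<nu> T < \<eta>" if "T \<subseteq> {j}" "T \<in> shift subsingletons l" for T
    proof -
      have "j \<notin> T"
      proof
        assume "j \<in> T"
        then have "T = {j}" "l < j" using that unfolding shift_def by auto
        then show False using that(2) unfolding shift_def subsingletons_def by simp
      qed
      then have "T = {}" using that(1) by blast
      then show ?thesis using N(4) by simp
    qed
    moreover have "sum \<nu> {j} = 1" "\<forall>j. 0 \<le> \<nu> j" unfolding \<nu>_def by auto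
    ultimately show "\<exists>D\<subseteq>N \<inter> {n..}. D \<in> fam \<delta> \<and>
      (\<exists>\<nu>::nat \<Rightarrow> real. (\<forall>j. 0 \<le> \<nu> j) \<and> sum \<nu> D = 1 \<and> (\<forall>T\<subseteq>D. T \<in> shift subsingletons l \<longrightarrow> sum \<nu> T < \<eta>))"
      using singleton_fam[OF \<delta>, of j] j by (intro exI[of _ "{j}"]) auto
  qed (simp add: subsingletons_def)
qed

text \<open>On the diagonal set, entries at least \<open>c\<close> cannot recur, since a tail would
  be a witness for \<open>subsingletons\<close>. The estimate is one-sided because only nonnegative
  entries are used on pieces.\<close>

lemma ex_small_coeffs:
  assumes M: "infinite M" and no: "\<And>N. N \<subseteq> M \<Longrightarrow> infinite N \<Longrightarrow> \<not> charged subsingletons N"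
  shows "\<exists>L\<subseteq>M. infinite L \<and> (\<forall>a c. bounded_coeffs L a \<longrightarrow> 0 < c \<longrightarrow> (\<exists>m. \<forall>j\<ge>m. a j < c))"
proof -
  define Q where "Q n L \<longleftrightarrow> (\<forall>a. \<not> witness subsingletons (1 / Suc n) L a)" for n L
  have "\<exists>L\<subseteq>N. infinite L \<and> Q n L" if "infinite N" "N \<subseteq> M" for n N
  proof -
    have "\<not> charged subsingletons N" using no that by auto
    then show ?thesis unfolding charged_def Q_def by (metis of_nat_0_less_iff zero_less_Suc zero_less_divide_1_iff)
  qed
  moreover have "Q n L" if "Q n N" "L \<subseteq> N" for n N L
    using that witness_mono[OF _ order_refl order_refl] unfolding Q_def by blast
  ultimately have "\<exists>L\<subseteq>M. infinite L \<and> (\<forall>n. \<exists>m. Q n (L \<inter> {m..}))"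
    by (intro diagonal[OF M, of Q])
  then obtain L where L: "L \<subseteq> M" "infinite L" "\<And>n. \<exists>m. Q n (L \<inter> {m..})" by blast
  have "\<exists>m. \<forall>j\<ge>m. a j < c" if a: "bounded_coeffs L a" and c: "0 < c" for a c
  proof (rule ccontr)
    assume contr: "\<not> ?thesis"
    have "\<exists>T\<in>subsingletons. T \<subseteq> L \<inter> {n..} \<and> (\<forall>j\<in>T. 0 \<le> a j) \<and> c \<le> sum a T" for n
    proof -
      obtain j where j: "n \<le> j" "c \<le> a j" using contr by (auto simp: not_less)
      then have "j \<in> L" using a c unfolding bounded_coeffs_def by (metis not_less)
      then show ?thesis using j c by (intro bexI[of _ "{j}"]) (auto simp: subsingletons_def)
    qed
    then have wit: "witness subsingletons c L a" using a unfolding witness_def by blast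
    obtain n where n: "1 / Suc n \<le> c / 2" using inverse_Suc_le[of "c/2"] c by auto
    obtain m where "Q n (L \<inter> {m..})" using L(3) by blast
    then show False
      using witness_mono[OF witness_tail[OF wit] order_refl n order_refl] unfolding Q_def by blast
  qed
  then show ?thesis using L by blast
qed

text \<open>A member \<open>T\<close> of \<S> with mass \<kappa> is prolonged by later nonnegative
  coordinates until it leaves \<S>. The first piece contains all of \<open>T\<close>, since an
  initial segment ending inside \<open>T\<close> would belong to \<S>. Small entries leave at least
  half of the mass after removal of the marker.\<close>

lemma ex_piece:
  assumes cf: "compact_family \<S>" and a: "witness \<S> \<kappa> N a"
    and vanish: "\<And>c. 0 < c \<Longrightarrow> \<exists>m. \<forall>j\<ge>m. a j < c" and \<kappa>: "0 < \<kappa>" and \<epsilon>: "0 < \<epsilon>"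
  shows "\<exists>B\<subseteq>N \<inter> {n..}. piece \<S> B \<and> (\<forall>j\<in>B. 0 \<le> a j) \<and> \<kappa> / 2 \<le> sum a (body B) \<and> a (Min B) \<le> \<epsilon>"
proof -
  obtain m where m: "\<And>j. m \<le> j \<Longrightarrow> a j < min \<epsilon> (\<kappa> / 2)" using vanish[of "min \<epsilon> (\<kappa>/2)"] \<epsilon> \<kappa> by auto
  have ex: "\<exists>T\<in>\<S>. T \<subseteq> N \<inter> {b..} \<and> (\<forall>j\<in>T. 0 \<le> a j) \<and> \<kappa> \<le> sum a T \<and> T \<noteq> {}" for b
  proof -
    obtain T where T: "T \<in> \<S>" "T \<subseteq> N \<inter> {b..}" "\<forall>j\<in>T. 0 \<le> a j" "\<kappa> \<le> sum a T"
      using a unfolding witness_def by blast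
    then have "T \<noteq> {}" using \<kappa> by auto
    then show ?thesis using T by blast
  qed
  obtain T where T: "T \<in> \<S>" "T \<subseteq> N \<inter> {max m n..}" "\<forall>j\<in>T. 0 \<le> a j" "\<kappa> \<le> sum a T" "T \<noteq> {}"
    using ex[of "max m n"] by blast
  have fT: "finite T" using compact_familyD(2)[OF cf T(1)] .
  define Y where "Y = T \<union> {j\<in>N. Max T < j \<and> 0 \<le> a j}"
  have "infinite Y"
    unfolding infinite_nat_iff_unbounded_le
  proof
    fix b
    obtain T' where T': "T' \<subseteq> N \<inter> {max b (Suc (Max T))..}" "\<forall>j\<in>T'. 0 \<le> a j" "T' \<noteq> {}"
      using ex[of "max b (Suc (Max T))"] by blast
    obtain j where "j \<in> T'" using T'(3) by blast
    then have "j \<in> N" "b \<le> j" "Suc (Max T) \<le> j" "0 \<le> a j" using T'(1,2) by auto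
    then show "\<exists>j\<ge>b. j \<in> Y" unfolding Y_def by auto
  qed
  then obtain p where "Y \<inter> {..<p} \<notin> \<S>" using compact_familyD(4)[OF cf] by blast
  then obtain q where q: "piece \<S> (Y \<inter> {..<q})" by (rule initial_piece[OF _ compact_familyD(1)[OF cf]])
  let ?B = "Y \<inter> {..<q}"
  have "T \<subseteq> ?B"
  proof (rule ccontr)
    assume "\<not> T \<subseteq> ?B"
    then obtain x where "x \<in> T" "q \<le> x" unfolding Y_def by fastforce
    then have "q \<le> Max T" using Max_ge[OF fT] by (meson order_trans)
    then have "?B \<subseteq> T" unfolding Y_def by auto
    then have "?B \<in> \<S>" using compact_familyD(3)[OF cf T(1)] by blast
    then show False using q unfolding piece_def by blast
  qed
  have Y: "j \<in> N" "max m n \<le> j" "0 \<le> a j" if "j \<in> Y" for j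
  proof -
    have "max m n \<le> Max T" using Max_in[OF fT T(5)] T(2) by auto
    then show "j \<in> N" "max m n \<le> j" "0 \<le> a j" using that T(2,3) unfolding Y_def by auto
  qed
  have fB: "finite ?B" "?B \<noteq> {}" using q unfolding piece_def by auto
  then have "Min ?B \<in> ?B" by (rule Min_in)
  have MinB: "a (Min ?B) \<le> \<epsilon>" "a (Min ?B) \<le> \<kappa> / 2"
    using m[of "Min ?B"] Y(2)[of "Min ?B"] \<open>Min ?B \<in> ?B\<close> by auto
  have "sum a ?B = a (Min ?B) + sum a (body ?B)"
    unfolding body_def using sum.remove[OF fB(1) \<open>Min ?B \<in> ?B\<close>, of a] .
  moreover have "sum a T \<le> sum a ?B" using fB(1) \<open>T \<subseteq> ?B\<close> Y(3) by (intro sum_mono2) auto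
  ultimately have "\<kappa> / 2 \<le> sum a (body ?B)" using T(4) MinB(2) by simp
  moreover have "?B \<subseteq> N \<inter> {n..}" using Y(1,2) by auto
  ultimately show ?thesis using q MinB(1) Y(3) by (intro exI[of _ ?B]) auto
qed

text \<open>If the spread-out measures required by \<open>c0_blocksI\<close> did not exist, the normalized coefficients of a witness
  would always charge a set in the shifted family, contradicting minimality.\<close>

lemma subsingletons_uncharged_case:
  assumes M: "infinite M" "charged (fam \<delta>) M" and \<delta>: "0 < \<delta>"
    and no: "\<And>N. N \<subseteq> M \<Longrightarrow> infinite N \<Longrightarrow> \<not> charged subsingletons N"
  shows "c0_blocks \<delta> M"
proof -
  obtain L where L: "L \<subseteq> M" "infinite L"
    "\<And>a c. bounded_coeffs L a \<Longrightarrow> 0 < c \<Longrightarrow> \<exists>m. \<forall>j\<ge>m. a j < c"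
    using ex_small_coeffs[OF M(1) no] by blast
  obtain \<S> P where \<S>: "\<S> \<subseteq> fam \<delta>" "compact_family \<S>" "P \<subseteq> L" "infinite P" "charged \<S> P"
    and min: "\<forall>l\<in>P. \<forall>N\<subseteq>P. infinite N \<longrightarrow> \<not> charged (shift \<S> l) N"
    using minimal_charged[OF compact_family_fam[OF \<delta>] L(2) charged_mono[OF M(2) L(1)]]
    by (elim exE conjE) (rule that)
  obtain \<kappa> where \<kappa>: "0 < \<kappa>" "\<And>N. N \<subseteq> P \<Longrightarrow> infinite N \<Longrightarrow> \<exists>a. witness \<S> \<kappa> N a"
    using \<S>(5) unfolding charged_def by blast
  define P' where "P' = {l\<in>P. {l} \<in> \<S>}"
  have "P' \<subseteq> P" unfolding P'_def by blast
  have "infinite P'"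
    unfolding infinite_nat_iff_unbounded_le
  proof
    fix n
    obtain T where "T \<in> \<S>" "T \<subseteq> P \<inter> {n..}" "T \<noteq> {}" using charged_unbounded[OF \<S>(5,4)] by blast
    then obtain j where "j \<in> P" "n \<le> j" "j \<in> T" by auto
    moreover have "{j} \<in> \<S>" using compact_familyD(3)[OF \<S>(2) \<open>T \<in> \<S>\<close>] \<open>j \<in> T\<close> by blast
    ultimately show "\<exists>j\<ge>n. j \<in> P'" unfolding P'_def by blast
  qed
  have "c0_blocks \<delta> P'"
  proof (rule c0_blocksI[OF \<S>(2) \<open>infinite P'\<close>])
    show "{l} \<in> \<S>" if "l \<in> P'" for l using that unfolding P'_def by blast
    show "0 < \<kappa> / 2" using \<kappa>(1) by simp
  next
    fix N assume N: "N \<subseteq> P'" "infinite N"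
    then obtain a where a: "witness \<S> \<kappa> N a" using \<kappa>(2) \<open>P' \<subseteq> P\<close> by (meson order_trans)
    then have "bounded_coeffs N a" unfolding witness_def by blast
    moreover have "bounded_coeffs L a"
      using \<open>bounded_coeffs N a\<close> bounded_coeffs_mono N(1) \<open>P' \<subseteq> P\<close> \<S>(3) by (meson order_trans)
    ultimately show "\<exists>a. bounded_coeffs N a \<and>
      (\<forall>n \<epsilon>. 0 < \<epsilon> \<longrightarrow> (\<exists>B\<subseteq>N \<inter> {n..}. piece \<S> B \<and> (\<forall>j\<in>B. 0 \<le> a j) \<and> \<kappa> / 2 \<le> sum a (body B) \<and> a (Min B) \<le> \<epsilon>))"
      using ex_piece[OF \<S>(2) a L(3) \<kappa>(1)] by blast
  next
    fix N l n and \<eta> :: real assume N: "N \<subseteq> P'" "infinite N" "l \<in> N" "0 < \<eta>"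
    show "\<exists>D\<subseteq>N \<inter> {n..}. D \<in> fam \<delta> \<and>
      (\<exists>\<nu>::nat \<Rightarrow> real. (\<forall>j. 0 \<le> \<nu> j) \<and> sum \<nu> D = 1 \<and> (\<forall>T\<subseteq>D. T \<in> shift \<S> l \<longrightarrow> sum \<nu> T < \<eta>))"
    proof (rule ccontr)
      assume contr: "\<not> ?thesis"
      have "\<exists>a. witness (shift \<S> l) (\<eta> * \<kappa>) L' a" if L': "L' \<subseteq> N \<inter> {n..}" "infinite L'" for L'
      proof -
        have "L' \<subseteq> P" using L'(1) N(1) \<open>P' \<subseteq> P\<close> by blast
        then obtain a where a: "witness \<S> \<kappa> L' a" using \<kappa>(2) L'(2) by blast
        have "\<exists>T\<in>shift \<S> l. T \<subseteq> L' \<inter> {b..} \<and> (\<forall>j\<in>T. 0 \<le> a j) \<and> \<eta> * \<kappa> \<le> sum a T" for b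
        proof -
          obtain S where S: "S \<in> \<S>" "S \<subseteq> L' \<inter> {b..}" "\<forall>j\<in>S. 0 \<le> a j" "\<kappa> \<le> sum a S"
            using a unfolding witness_def by blast
          have pos: "0 < sum a S" using S(4) \<kappa>(1) by simp
          define \<nu> where "\<nu> j = (if j \<in> S then a j / sum a S else 0)" for j
          have \<nu>: "sum \<nu> T = sum a T / sum a S" if "T \<subseteq> S" for T
            using that unfolding \<nu>_def sum_divide_distrib by (intro sum.cong) auto
          have "\<forall>j. 0 \<le> \<nu> j" using S(3) pos unfolding \<nu>_def by auto
          moreover have "sum \<nu> S = 1" using \<nu>[OF order_refl] pos by simp
          \<comment> \<open>The minimal family lies inside \<open>fam \<delta>\<close>; this makes
            the support of the measure admissible for a block of norm at least \<delta>.\<close>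
          moreover have "S \<in> fam \<delta>" "S \<subseteq> N \<inter> {n..}" using S(1,2) \<S>(1) L'(1) by auto
          ultimately obtain T where T: "T \<subseteq> S" "T \<in> shift \<S> l" "\<eta> \<le> sum \<nu> T"
            using contr by (meson not_less)
          have "\<eta> * \<kappa> \<le> \<eta> * sum a S" using S(4) N(4) by simp
          also have "\<dots> \<le> sum a T" using T(3) pos unfolding \<nu>[OF T(1)] by (simp add: field_simps)
          finally show ?thesis using T(1,2) S(2,3) by (intro bexI[of _ T]) auto
        qed
        then show ?thesis using a unfolding witness_def by blast
      qed
      moreover have "0 < \<eta> * \<kappa>" using N(4) \<kappa>(1) by simp
      ultimately have "charged (shift \<S> l) (N \<inter> {n..})" unfolding charged_def by blast
      moreover have "l \<in> P" "N \<inter> {n..} \<subseteq> P" using N(1,3) \<open>P' \<subseteq> P\<close> by auto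
      ultimately show False using min infinite_Int_atLeast[OF N(2)] by blast
    qed
  qed
  moreover have "P' \<subseteq> M" using \<open>P' \<subseteq> P\<close> \<S>(3) L(1) by blast
  ultimately show ?thesis by (rule c0_blocks_mono)
qed

theorem ex_c0_blocks:
  assumes "\<And>L. infinite L \<Longrightarrow> \<exists>\<delta>>0. \<exists>a. witness (fam \<delta>) \<delta> L a"
  shows "\<exists>\<delta>>0. c0_blocks \<delta> UNIV"
proof -
  obtain M \<delta> where M: "infinite M" "0 < \<delta>" "\<delta> \<le> 1" "charged (fam \<delta>) M" using ex_uniform[OF assms] by blast
  have "c0_blocks \<delta> UNIV"
  proof (cases "\<exists>N\<subseteq>M. infinite N \<and> charged subsingletons N")
    case True
    then obtain N where "infinite N" "charged subsingletons N" by blast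
    then show ?thesis using subsingletons_charged_case[OF _ _ M(3)] c0_blocks_mono subset_UNIV by blast
  next
    case False
    then have "\<And>N. N \<subseteq> M \<Longrightarrow> infinite N \<Longrightarrow> \<not> charged subsingletons N" by blast
    then show ?thesis using subsingletons_uncharged_case[OF M(1,4,2)] c0_blocks_mono subset_UNIV by blast
  qed
  then show ?thesis using M(2) by blast
qed

end

section \<open>The dual ball\<close>

definition sublin :: "('a::real_vector \<Rightarrow> real) \<Rightarrow> bool" where
  "sublin p \<longleftrightarrow> (\<forall>u v. p (u + v) \<le> p u + p v) \<and> (\<forall>c v. 0 < c \<longrightarrow> p (c *\<^sub>R v) \<le> c * p v) \<and> p 0 = 0"

lemma sublinD:
  assumes "sublin p"
  shows "p (u + v) \<le> p u + p v" "0 \<le> c \<Longrightarrow> p (c *\<^sub>R v) = c * p v" "- p (- v) \<le> p v"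
proof -
  show add: "p (u + v) \<le> p u + p v" for u v using assms unfolding sublin_def by blast
  show "p (c *\<^sub>R v) = c * p v" if "0 \<le> c"
  proof (cases "c = 0")
    case True then show ?thesis using assms unfolding sublin_def by simp
  next
    case False
    then have c: "0 < c" "0 < 1 / c" using that by auto
    have le: "p (d *\<^sub>R w) \<le> d * p w" if "0 < d" for d w using assms that unfolding sublin_def by blast
    have "p v \<le> (1 / c) * p (c *\<^sub>R v)" using le[OF c(2), of "c *\<^sub>R v"] c(1) by simp
    then have "c * p v \<le> p (c *\<^sub>R v)" using c(1) by (simp add: field_simps)
    then show ?thesis using le[OF c(1), of v] by simp
  qed
  show "- p (- v) \<le> p v" using add[of v "- v"] assms unfolding sublin_def by simp
qed

text \<open>A classical step towards the Hahn-Banach theorem: \<open>q v\<close> is the infimum of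
  \<open>p (v + t *\<^sub>R y) - t * p y\<close> over nonnegative \<open>t\<close>. The value at 0
  gives the first bound and the value at 1 the second, which for minimal \<open>p\<close> reverses
  subadditivity.\<close>

lemma sublin_lower:
  assumes p: "sublin p"
  shows "\<exists>q. sublin q \<and> (\<forall>v. q v \<le> p v \<and> q v \<le> p (v + y) - p y)"
proof -
  define g where "g v t = p (v + t *\<^sub>R y) - t * p y" for v t
  define q where "q v = (INF t\<in>{0..}. g v t)" for v
  have lb: "- p (- v) \<le> g v t" if "0 \<le> t" for v t
  proof -
    have "t * p y = p ((v + t *\<^sub>R y) + (- v))" using sublinD(2)[OF p that, of y] by simp
    also have "\<dots> \<le> p (v + t *\<^sub>R y) + p (- v)" by (rule sublinD(1)[OF p])
    finally show ?thesis unfolding g_def by simp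
  qed
  have bdd: "bdd_below (g v ` {0..})" for v
    by (rule bdd_belowI2[of _ "- p (- v)"]) (use lb in auto)
  have q_le: "q v \<le> g v t" if "0 \<le> t" for v t
    unfolding q_def by (rule cINF_lower[OF bdd]) (use that in auto)
  have q_ge: "b \<le> q v" if "\<And>t. 0 \<le> t \<Longrightarrow> b \<le> g v t" for b v
    unfolding q_def by (rule cINF_greatest) (use that in auto)
  have qp: "q v \<le> p v" for v using q_le[of 0 v] unfolding g_def by simp
  have "q v \<le> p (v + y) - p y" for v using q_le[of 1 v] unfolding g_def by simp
  moreover have "sublin q"
    unfolding sublin_def
  proof (intro conjI allI impI)
    fix u v
    have *: "q (u + v) \<le> g u s + g v t" if "0 \<le> s" "0 \<le> t" for s t
    proof -
      have "q (u + v) \<le> g (u + v) (s + t)" using that by (intro q_le) simp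
      also have "\<dots> \<le> g u s + g v t"
        using sublinD(1)[OF p, of "u + s *\<^sub>R y" "v + t *\<^sub>R y"]
        unfolding g_def by (simp add: algebra_simps)
      finally show ?thesis .
    qed
    have "q (u + v) - g u s \<le> q v" if "0 \<le> s" for s
      by (rule q_ge) (use *[OF that] in \<open>simp add: algebra_simps\<close>)
    then have "q (u + v) - q v \<le> q u" by (intro q_ge) (simp add: algebra_simps)
    then show "q (u + v) \<le> q u + q v" by simp
  next
    fix c v assume c: "0 < (c::real)"
    have "q (c *\<^sub>R v) / c \<le> g v t" if "0 \<le> t" for t
    proof -
      have "q (c *\<^sub>R v) \<le> g (c *\<^sub>R v) (c * t)" using c that by (intro q_le) simp
      also have "\<dots> = c * g v t"
        using sublinD(2)[OF p, of c "v + t *\<^sub>R y"] c unfolding g_def by (simp add: algebra_simps)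
      finally show ?thesis using c by (simp add: field_simps)
    qed
    then have "q (c *\<^sub>R v) / c \<le> q v" by (rule q_ge)
    then show "q (c *\<^sub>R v) \<le> c * q v" using c by (simp add: field_simps)
  next
    have "p 0 = 0" using p unfolding sublin_def by blast
    then have "0 \<le> q 0" using lb[of _ 0] by (intro q_ge) simp
    then show "q 0 = 0" using qp[of 0] \<open>p 0 = 0\<close> by simp
  qed
  ultimately show ?thesis using qp by blast
qed

text \<open>A minimal sublinear functional is linear, by \<open>sublin_lower\<close>.\<close>

lemma ex_linear_below_sublin:
  fixes p0 :: "'a::real_vector \<Rightarrow> real"
  assumes p0: "sublin p0"
  shows "\<exists>p. linear p \<and> (\<forall>v. p v \<le> p0 v)"
proof -
  define A where "A = {p. sublin p \<and> (\<forall>v. p v \<le> p0 v)}"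
  \<comment> \<open>The order is reversed, so the maximal elements of Zorn's lemma are minimal
    functionals.\<close>
  define P where "P p q \<longleftrightarrow> (\<forall>v. q v \<le> p v)" for p q :: "'a \<Rightarrow> real"
  have "\<exists>m\<in>A. \<forall>a\<in>A. P m a \<longrightarrow> a = m"
  proof (rule predicate_Zorn)
    show "partial_order_on A (relation_of P A)"
      by (rule partial_order_on_relation_ofI) (auto simp: P_def fun_eq_iff intro: order_trans antisym)
  next
    fix C assume "C \<in> Chains (relation_of P A)"
    then have C: "C \<subseteq> A" "\<And>p q. p \<in> C \<Longrightarrow> q \<in> C \<Longrightarrow> P p q \<or> P q p"
      unfolding Chains_def relation_of_def by auto
    show "\<exists>u\<in>A. \<forall>a\<in>C. P a u"
    proof (cases "C = {}")
      case True then show ?thesis using p0 unfolding A_def by auto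
    next
      case False
      then obtain p1 where p1: "p1 \<in> C" by blast
      define u where "u v = (INF p\<in>C. p v)" for v
      have sub: "sublin p" "p v \<le> p0 v" if "p \<in> C" for p v using C(1) that unfolding A_def by auto
      have "- p0 (- v) \<le> p v" if "p \<in> C" for p v
        using sublinD(3)[OF sub(1)[OF that], of v] sub(2)[OF that, of "- v"] by simp
      then have bdd: "bdd_below ((\<lambda>p. p v) ` C)" for v by (intro bdd_belowI2) auto
      have u_le: "u v \<le> p v" if "p \<in> C" for p v unfolding u_def by (rule cINF_lower[OF bdd that])
      have u_ge: "b \<le> u v" if "\<And>p. p \<in> C \<Longrightarrow> b \<le> p v" for b v
        unfolding u_def by (rule cINF_greatest[OF False that])
      have "sublin u"
        unfolding sublin_def
      proof (intro conjI allI impI)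
        fix v w
        have *: "u (v + w) \<le> p v + q w" if "p \<in> C" "q \<in> C" for p q
        proof -
          have "\<exists>r\<in>C. r v \<le> p v \<and> r w \<le> q w" using C(2)[OF that] that unfolding P_def by blast
          then obtain r where "r \<in> C" "r v \<le> p v" "r w \<le> q w" by blast
          then show ?thesis using u_le[of r "v + w"] sublinD(1)[OF sub(1), of r v w] by simp
        qed
        have "u (v + w) - p v \<le> u w" if "p \<in> C" for p
          by (rule u_ge) (use *[OF that] in \<open>simp add: algebra_simps\<close>)
        then have "u (v + w) - u w \<le> u v" by (intro u_ge) (simp add: algebra_simps)
        then show "u (v + w) \<le> u v + u w" by simp
      next
        fix c v assume c: "0 < (c::real)"
        have "u (c *\<^sub>R v) / c \<le> u v"
        proof (rule u_ge)
          fix p assume "p \<in> C"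
          then have "u (c *\<^sub>R v) \<le> c * p v" using u_le[of p "c *\<^sub>R v"] sublinD(2)[OF sub(1), of p c v] c by simp
          then show "u (c *\<^sub>R v) / c \<le> p v" using c by (simp add: field_simps)
        qed
        then show "u (c *\<^sub>R v) \<le> c * u v" using c by (simp add: field_simps)
      next
        have "p 0 = 0" if "p \<in> C" for p using sub(1)[OF that] unfolding sublin_def by blast
        then have "(\<lambda>p. p 0) ` C = {0}" using False by force
        then show "u 0 = 0" unfolding u_def by simp
      qed
      moreover have "u v \<le> p0 v" for v using u_le[OF p1, of v] sub(2)[OF p1, of v] by simp
      ultimately show ?thesis using u_le unfolding A_def P_def by blast
    qed
  qed
  then obtain p where p: "sublin p" "\<And>v. p v \<le> p0 v"
    and min: "\<And>q. sublin q \<Longrightarrow> \<forall>v. q v \<le> p0 v \<Longrightarrow> \<forall>v. q v \<le> p v \<Longrightarrow> q = p"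
    unfolding A_def P_def by auto
  have add: "p (v + y) = p v + p y" for v y
  proof -
    obtain q where q: "sublin q" "\<And>v. q v \<le> p v" "\<And>v. q v \<le> p (v + y) - p y"
      using sublin_lower[OF p(1), of y] by blast
    then have "q = p" using p(2) by (intro min) (auto intro: order_trans)
    then show ?thesis using q(3)[of v] sublinD(1)[OF p(1), of v y] by simp
  qed
  have neg: "p (- v) = - p v" for v using add[of v "- v"] p(1) unfolding sublin_def by simp
  have "p (c *\<^sub>R v) = c * p v" for c v
  proof (cases "0 \<le> c")
    case True then show ?thesis by (rule sublinD(2)[OF p(1)])
  next
    case False
    then have "p ((- c) *\<^sub>R v) = - c * p v" by (intro sublinD(2)[OF p(1)]) simp
    then show ?thesis using neg[of "c *\<^sub>R v"] by simp
  qed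
  then have "linear p" using add by (intro linearI) auto
  then show ?thesis using p(2) by blast
qed

text \<open>Plain functions are used so that the product topology on the function type is the weak*
  topology.\<close>

definition dual_ball :: "('a::real_normed_vector \<Rightarrow> real) set" where
  "dual_ball = {f. linear f \<and> (\<forall>v. \<bar>f v\<bar> \<le> norm v)}"

text \<open>Lowering the norm in direction \<open>v\<close> before passing to a linear functional
  yields a bound of \<open>- norm v\<close> at \<open>- v\<close>, which forces equality at
  \<open>v\<close>.\<close>

lemma dual_ball_norming: "\<exists>f\<in>dual_ball. f v = norm v" for v :: "'a::real_normed_vector"
proof -
  have "sublin (norm :: 'a \<Rightarrow> real)" unfolding sublin_def by (auto simp: norm_triangle_ineq)
  then obtain q :: "'a \<Rightarrow> real" where q: "sublin q" "\<And>w. q w \<le> norm w" "\<And>w. q w \<le> norm (w + v) - norm v"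
    using sublin_lower[of norm v] by blast
  obtain f where f: "linear f" "\<And>w. f w \<le> q w" using ex_linear_below_sublin[OF q(1)] by blast
  have fn: "f w \<le> norm w" for w using f(2)[of w] q(2)[of w] by simp
  have neg: "f (- w) = - f w" for w by (rule linear_neg[OF f(1)])
  have "\<bar>f w\<bar> \<le> norm w" for w using fn[of w] fn[of "- w"] neg[of w] by simp
  moreover have "f v = norm v" using fn[of v] f(2)[of "- v"] q(3)[of "- v"] neg[of v] by simp
  ultimately show ?thesis using f(1) unfolding dual_ball_def by blast
qed

lemma dual_ball_bounded_linear: "f \<in> dual_ball \<Longrightarrow> bounded_linear f"
  unfolding dual_ball_def
  by (auto intro!: bounded_linear_intro[of _ 1] simp: linear_add linear_scale)

text \<open>The Banach-Alaoglu theorem: a product of compact intervals is compact by Tychonoff, and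
  each linearity condition involves finitely many coordinates and is closed.\<close>

lemma compact_dual_ball: "compact (dual_ball :: ('a::real_normed_vector \<Rightarrow> real) set)"
proof -
  let ?B = "PiE UNIV (\<lambda>v::'a. {- norm v..norm v})"
  let ?A = "\<Inter>u v. {f :: 'a \<Rightarrow> real. f (u + v) = f u + f v}"
  let ?S = "\<Inter>c v. {f :: 'a \<Rightarrow> real. f (c *\<^sub>R v) = c * f v}"
  have "compact ?B"
    unfolding compactin_euclidean_iff[symmetric] euclidean_product_topology[symmetric] compactin_PiE
    by simp
  moreover have "closed ?A" "closed ?S"
    by (intro closed_INT ballI closed_Collect_eq continuous_intros; simp)+
  ultimately have "compact (?B \<inter> (?A \<inter> ?S))" by (intro compact_Int_closed closed_Int)
  moreover have "dual_ball = ?B \<inter> (?A \<inter> ?S)"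
    unfolding dual_ball_def by (auto simp: linear_iff abs_le_iff PiE_iff) (smt (verit))+
  ultimately show ?thesis by simp
qed

text \<open>If every finite part of \<open>J\<close> had a functional above \<epsilon> throughout,
  compactness would give one functional that is at least \<epsilon> in modulus on all of
  \<open>J\<close>, against weak nullness.\<close>

lemma weakly_null_uniform:
  fixes x :: "nat \<Rightarrow> 'a::real_normed_vector"
  assumes "weakly_null x" "0 < \<epsilon>" "infinite J"
  shows "\<exists>J0\<subseteq>J. finite J0 \<and> (\<forall>f\<in>dual_ball. \<exists>j\<in>J0. \<bar>f (x j)\<bar> \<le> \<epsilon>)"
proof (rule ccontr)
  assume contr: "\<not> ?thesis"
  have "dual_ball \<inter> (\<Inter>j\<in>J. {f. \<epsilon> \<le> \<bar>f (x j)\<bar>}) \<noteq> {}"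
  proof (rule compact_imp_fip_image[OF compact_dual_ball])
    show "closed {f :: 'a \<Rightarrow> real. \<epsilon> \<le> \<bar>f (x j)\<bar>}" for j
      by (intro closed_Collect_le continuous_intros) simp
    show "dual_ball \<inter> (\<Inter>j\<in>J'. {f. \<epsilon> \<le> \<bar>f (x j)\<bar>}) \<noteq> {}" if "finite J'" "J' \<subseteq> J" for J'
    proof -
      have "\<not> (\<forall>f\<in>dual_ball. \<exists>j\<in>J'. \<bar>f (x j)\<bar> \<le> \<epsilon>)" using contr that by blast
      then obtain f where "f \<in> dual_ball" "\<forall>j\<in>J'. \<epsilon> < \<bar>f (x j)\<bar>" by (meson not_le)
      then have "f \<in> dual_ball \<inter> (\<Inter>j\<in>J'. {f. \<epsilon> \<le> \<bar>f (x j)\<bar>})" by (auto intro: less_imp_le)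
      then show ?thesis by blast
    qed
  qed
  then obtain f where f: "f \<in> dual_ball" "\<And>j. j \<in> J \<Longrightarrow> \<epsilon> \<le> \<bar>f (x j)\<bar>" by auto
  have "(\<lambda>j. f (x j)) \<longlonglongrightarrow> 0"
    using assms(1) dual_ball_bounded_linear[OF f(1)] unfolding weakly_null_def by blast
  then obtain N where "\<And>j. N \<le> j \<Longrightarrow> \<bar>f (x j)\<bar> < \<epsilon>"
    using LIMSEQ_D[of "\<lambda>j. f (x j)" 0 \<epsilon>] assms(2) by auto
  moreover obtain j where "j \<in> J" "N \<le> j" using assms(3) by (meson infinite_nat_iff_unbounded_le)
  ultimately show False using f(2)[of j] by fastforce
qed

section \<open>Coefficients of weakly null sequences\<close>

definition coeffs :: "(nat \<Rightarrow> 'a::real_normed_vector) \<Rightarrow> (nat \<Rightarrow> real) set" where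
  "coeffs x = (\<lambda>f j. f (x j)) ` dual_ball"

lemma coeffs_uminus:
  assumes k: "k \<in> coeffs x" shows "(\<lambda>j. - k j) \<in> coeffs x"
proof -
  obtain f where f: "k = (\<lambda>j. f (x j))" "f \<in> dual_ball" using k unfolding coeffs_def by blast
  then have "(\<lambda>v. - f v) \<in> dual_ball" unfolding dual_ball_def by (simp add: linear_compose_neg)
  then show ?thesis using f(1) unfolding coeffs_def by (intro image_eqI[of _ _ "\<lambda>v. - f v"]) auto
qed

lemma coefficient_set_coeffs:
  assumes x: "normalized x" "weakly_null x"
  shows "coefficient_set (coeffs x)"
proof
  have norm1: "norm (x j) = 1" for j using x(1) unfolding normalized_def by blast
  show "\<bar>k j\<bar> \<le> 1" if k: "k \<in> coeffs x" for k j
  proof -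
    obtain f where f: "k = (\<lambda>j. f (x j))" "f \<in> dual_ball" using k unfolding coeffs_def by blast
    then have "\<bar>f (x j)\<bar> \<le> norm (x j)" unfolding dual_ball_def by blast
    then show ?thesis using f(1) norm1 by simp
  qed
  show "(\<lambda>j. - k j) \<in> coeffs x" if "k \<in> coeffs x" for k using that by (rule coeffs_uminus)
  show "\<exists>k\<in>coeffs x. k j = 1" for j
    using dual_ball_norming[of "x j"] norm1 unfolding coeffs_def by auto
  show "\<exists>J0\<subseteq>J. finite J0 \<and> (\<forall>k\<in>coeffs x. \<exists>j\<in>J0. \<bar>k j\<bar> \<le> \<epsilon>)" if "0 < \<epsilon>" "infinite J" for \<epsilon> J
    using weakly_null_uniform[OF x(2) that] unfolding coeffs_def by simp
qed

lemma linear_sum_scaleR: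
  assumes "linear f" shows "f (\<Sum>j\<in>F. c j *\<^sub>R x j) = (\<Sum>j\<in>F. c j * f (x j))"
  using assms by (simp add: linear_sum linear_scale)

lemma coeffs_le_norm:
  assumes "k \<in> coeffs x"
  shows "\<bar>\<Sum>j\<in>F. c j * k j\<bar> \<le> norm (\<Sum>j\<in>F. c j *\<^sub>R x j)"
proof -
  obtain f where f: "k = (\<lambda>j. f (x j))" "linear f" "\<And>v. \<bar>f v\<bar> \<le> norm v"
    using assms unfolding coeffs_def dual_ball_def by auto
  show ?thesis using f(3)[of "\<Sum>j\<in>F. c j *\<^sub>R x j"] unfolding linear_sum_scaleR[OF f(2)] f(1) .
qed

lemma coeffs_norming:
  obtains k where "k \<in> coeffs x" "norm (\<Sum>j\<in>F. c j *\<^sub>R x j) = (\<Sum>j\<in>F. c j * k j)"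
proof -
  obtain f where f: "f \<in> dual_ball" "f (\<Sum>j\<in>F. c j *\<^sub>R x j) = norm (\<Sum>j\<in>F. c j *\<^sub>R x j)"
    using dual_ball_norming by blast
  then have "norm (\<Sum>j\<in>F. c j *\<^sub>R x j) = (\<Sum>j\<in>F. c j * f (x j))"
    using linear_sum_scaleR[of f c x F] unfolding dual_ball_def by simp
  then show ?thesis using that[of "\<lambda>j. f (x j)"] f(1) unfolding coeffs_def by blast
qed

lemma norm_sum_le:
  assumes "normalized x" shows "norm (\<Sum>j\<in>F. c j *\<^sub>R x j) \<le> (\<Sum>j\<in>F. \<bar>c j\<bar>)"
  using norm_sum[of "\<lambda>j. c j *\<^sub>R x j" F] assms unfolding normalized_def by simp

lemma normalized_comp: "normalized x \<Longrightarrow> normalized (x \<circ> r)"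
  unfolding normalized_def by simp

lemma weakly_null_comp:
  assumes "weakly_null x" "strict_mono r" shows "weakly_null (x \<circ> r)"
  unfolding weakly_null_def
proof (intro allI impI)
  fix f :: "'a \<Rightarrow> real" assume "bounded_linear f"
  then have "(\<lambda>j. f (x j)) \<longlonglongrightarrow> 0" using assms(1) unfolding weakly_null_def by blast
  from LIMSEQ_subseq_LIMSEQ[OF this assms(2)] show "(\<lambda>j. f ((x \<circ> r) j)) \<longlonglongrightarrow> 0"
    by (simp add: comp_def)
qed

section \<open>The quantities \<open>tau_n\<close> for a normalized sequence\<close>

lemma tau_set:
  fixes x :: "nat \<Rightarrow> 'a::real_normed_vector"
  assumes "normalized x"
  defines "S a n \<equiv> {norm (\<Sum>j\<in>F. a j *\<^sub>R x j) | F. finite F \<and> (\<forall>j\<in>F. n \<le> j) \<and> (\<Sum>j\<in>F. \<bar>a j\<bar>) \<le> 1}"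
  shows "0 \<in> S a n" "bdd_above (S a n)"
proof -
  show "0 \<in> S a n" unfolding S_def by (rule CollectI, rule exI[of _ "{}"]) simp
  show "bdd_above (S a n)"
    by (rule bdd_aboveI[of _ 1]) (use norm_sum_le[OF assms(1)] order_trans in \<open>fastforce simp: S_def\<close>)
qed

lemma tau_n_ge:
  assumes "normalized x" "finite F" "\<And>j. j \<in> F \<Longrightarrow> n \<le> j" "(\<Sum>j\<in>F. \<bar>a j\<bar>) \<le> 1"
  shows "norm (\<Sum>j\<in>F. a j *\<^sub>R x j) \<le> tau_n a x n"
  unfolding tau_n_def by (rule cSup_upper[OF _ tau_set(2)[OF assms(1)]]) (use assms in blast)

lemma tau_n_antimono:
  assumes "normalized x" "m \<le> n" shows "tau_n a x n \<le> tau_n a x m"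
proof -
  let ?S = "\<lambda>n. {norm (\<Sum>j\<in>F. a j *\<^sub>R x j) | F. finite F \<and> (\<forall>j\<in>F. n \<le> j) \<and> (\<Sum>j\<in>F. \<bar>a j\<bar>) \<le> 1}"
  have "?S n \<subseteq> ?S m"
  proof
    fix s assume "s \<in> ?S n"
    then obtain F where "s = norm (\<Sum>j\<in>F. a j *\<^sub>R x j)" "finite F" "\<forall>j\<in>F. n \<le> j" "(\<Sum>j\<in>F. \<bar>a j\<bar>) \<le> 1" by blast
    moreover from this(3) have "\<forall>j\<in>F. m \<le> j" using assms(2) by (meson order_trans)
    ultimately show "s \<in> ?S m" by blast
  qed
  moreover have "?S n \<noteq> {}" using tau_set(1)[OF assms(1), of a n] by (rule ex_in_conv[THEN iffD1, OF exI])
  ultimately show ?thesis unfolding tau_n_def by (intro cSup_subset_mono tau_set(2)[OF assms(1)])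
qed

lemma tau_n_less:
  assumes "normalized x" "c < tau_n a x n"
  obtains F where "finite F" "\<And>j. j \<in> F \<Longrightarrow> n \<le> j" "(\<Sum>j\<in>F. \<bar>a j\<bar>) \<le> 1" "c < norm (\<Sum>j\<in>F. a j *\<^sub>R x j)"
proof -
  have "\<exists>s\<in>{norm (\<Sum>j\<in>F. a j *\<^sub>R x j) | F. finite F \<and> (\<forall>j\<in>F. n \<le> j) \<and> (\<Sum>j\<in>F. \<bar>a j\<bar>) \<le> 1}. c < s"
    using assms(2) less_cSup_iff[OF _ tau_set(2)[OF assms(1)], of a n c] tau_set(1)[OF assms(1), of a n]
    unfolding tau_n_def by blast
  then show ?thesis using that by blast
qed

lemma tau_n_not_tendsto_0:
  assumes "normalized x" "\<not> (\<lambda>n. tau_n a x n) \<longlonglongrightarrow> 0"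
  obtains \<epsilon> where "0 < \<epsilon>" "\<And>n. \<epsilon> \<le> tau_n a x n"
proof -
  have "0 \<le> tau_n a x n" for n using tau_n_ge[OF assms(1), of "{}" n a] by simp
  then have "\<exists>\<epsilon>>0. \<forall>m. \<exists>n\<ge>m. \<epsilon> \<le> tau_n a x n"
    using assms(2) unfolding LIMSEQ_iff by (auto simp: not_less)
  then obtain \<epsilon> where "0 < \<epsilon>" "\<And>m. \<exists>n\<ge>m. \<epsilon> \<le> tau_n a x n" by blast
  then show ?thesis using that tau_n_antimono[OF assms(1)] by (meson order_trans)
qed

text \<open>Norm a finite combination of large norm by some \<open>k\<close>. Terms with
  \<open>k j\<close> below \<delta> in modulus, or with negative product, contribute at most
  \<delta> in total; the others split by sign into two sets, one of which has mass at least
  \<delta>. Goodness for \<open>n\<close> implies goodness for smaller indices, so one sign serves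
  all \<open>n\<close>.\<close>

lemma not_bcc_same_sign:
  fixes x :: "nat \<Rightarrow> 'a::real_normed_vector"
  assumes x: "normalized x" and tau: "\<not> (\<lambda>n. tau_n a x n) \<longlonglongrightarrow> 0"
  obtains \<delta> s where "0 < \<delta>" "\<bar>s\<bar> = 1"
    "\<And>n. \<exists>T. finite T \<and> (\<forall>j\<in>T. n \<le> j \<and> 0 \<le> s * a j) \<and> \<delta> \<le> (\<Sum>j\<in>T. s * a j) \<and> (\<exists>k\<in>coeffs x. \<forall>j\<in>T. \<delta> \<le> k j)"
proof -
  obtain \<epsilon> where \<epsilon>: "0 < \<epsilon>" "\<And>n. \<epsilon> \<le> tau_n a x n" using tau_n_not_tendsto_0[OF x tau] by blast
  define \<delta> where "\<delta> = \<epsilon> / 8"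
  have \<delta>: "0 < \<delta>" "\<epsilon> = 8 * \<delta>" using \<epsilon>(1) unfolding \<delta>_def by auto
  define good where "good s n \<longleftrightarrow> (\<exists>T. finite T \<and> (\<forall>j\<in>T. n \<le> j \<and> 0 \<le> s * a j) \<and> \<delta> \<le> (\<Sum>j\<in>T. s * a j) \<and>
      (\<exists>k\<in>coeffs x. \<forall>j\<in>T. \<delta> \<le> k j))" for s n
  have "good 1 n \<or> good (- 1) n" for n
  proof -
    have less: "4 * \<delta> < tau_n a x n" using \<epsilon>(2)[of n] \<delta> by simp
    obtain F where F: "finite F" "\<And>j. j \<in> F \<Longrightarrow> n \<le> j" "(\<Sum>j\<in>F. \<bar>a j\<bar>) \<le> 1"
      "4 * \<delta> < norm (\<Sum>j\<in>F. a j *\<^sub>R x j)" by (rule tau_n_less[OF x less]) (rule that)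
    obtain k where k: "k \<in> coeffs x" "norm (\<Sum>j\<in>F. a j *\<^sub>R x j) = (\<Sum>j\<in>F. a j * k j)"
      by (rule coeffs_norming)
    have k1: "\<bar>k j\<bar> \<le> 1" for j using coeffs_le_norm[OF k(1), of "\<lambda>_. 1" "{j}"] x unfolding normalized_def by simp
    let ?P = "{j\<in>F. 0 \<le> a j \<and> \<delta> \<le> k j}" and ?N = "{j\<in>F. a j \<le> 0 \<and> k j \<le> - \<delta>}"
    have le: "a j * k j \<le> \<delta> * \<bar>a j\<bar> + (if j \<in> ?P then a j else 0) + (if j \<in> ?N then - a j else 0)" if "j \<in> F" for j
    proof (cases "\<delta> \<le> \<bar>k j\<bar> \<and> 0 \<le> a j * k j")
      case True
      have ak: "a j * k j \<le> \<bar>a j\<bar>"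
      proof -
        have "a j * k j \<le> \<bar>a j\<bar> * \<bar>k j\<bar>" by (metis abs_ge_self abs_mult)
        also have "\<dots> \<le> \<bar>a j\<bar> * 1" by (intro mult_left_mono k1) simp
        finally show ?thesis by simp
      qed
      have pos: "0 \<le> \<delta> * \<bar>a j\<bar>" using \<delta>(1) by simp
      consider "\<delta> \<le> k j" | "k j \<le> - \<delta>" using True by linarith
      then show ?thesis
      proof cases
        case 1
        then have "0 < k j" using \<delta>(1) by simp
        then have a: "0 \<le> a j" using True by (simp add: zero_le_mult_iff)
        then have "(if j \<in> ?P then a j else 0) = a j" using 1 that by simp
        moreover have "0 \<le> (if j \<in> ?N then - a j else 0)" by simp
        ultimately show ?thesis using ak pos abs_of_nonneg[OF a] by linarith
      next
        case 2
        then have "k j < 0" using \<delta>(1) by simp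
        then have a: "a j \<le> 0" using True by (simp add: zero_le_mult_iff)
        then have "(if j \<in> ?N then - a j else 0) = - a j" using 2 that by simp
        moreover have "0 \<le> (if j \<in> ?P then a j else 0)" by simp
        ultimately show ?thesis using ak pos abs_of_nonpos[OF a] by linarith
      qed
    next
      case False
      have "a j * k j \<le> \<delta> * \<bar>a j\<bar>"
      proof (cases "0 \<le> a j * k j")
        case True
        then have "\<bar>k j\<bar> \<le> \<delta>" using False by simp
        then have "\<bar>k j\<bar> * \<bar>a j\<bar> \<le> \<delta> * \<bar>a j\<bar>" by (rule mult_right_mono) simp
        moreover have "a j * k j \<le> \<bar>k j\<bar> * \<bar>a j\<bar>" by (metis abs_ge_self abs_mult mult.commute)
        ultimately show ?thesis by simp
      next
        case False
        moreover have "0 \<le> \<delta> * \<bar>a j\<bar>" using \<delta>(1) by simp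
        ultimately show ?thesis by linarith
      qed
      moreover have "0 \<le> (if j \<in> ?P then a j else 0)" "0 \<le> (if j \<in> ?N then - a j else 0)" by simp_all
      ultimately show ?thesis by linarith
    qed
    have "4 * \<delta> < (\<Sum>j\<in>F. a j * k j)" using F(4) k(2) by simp
    also have "\<dots> \<le> (\<Sum>j\<in>F. \<delta> * \<bar>a j\<bar> + (if j \<in> ?P then a j else 0) + (if j \<in> ?N then - a j else 0))"
      using le by (rule sum_mono)
    also have "\<dots> = \<delta> * (\<Sum>j\<in>F. \<bar>a j\<bar>) + (\<Sum>j\<in>F. if j \<in> ?P then a j else 0) + (\<Sum>j\<in>F. if j \<in> ?N then - a j else 0)"
      by (simp only: sum.distrib sum_distrib_left)
    also have "(\<Sum>j\<in>F. if j \<in> ?P then a j else 0) = sum a ?P"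
      using F(1) by (simp add: sum.inter_filter)
    also have "(\<Sum>j\<in>F. if j \<in> ?N then - a j else 0) = (\<Sum>j\<in>?N. - a j)"
      using F(1) by (simp add: sum.inter_filter)
    also have "\<delta> * (\<Sum>j\<in>F. \<bar>a j\<bar>) \<le> \<delta> * 1" using F(3) \<delta>(1) by (intro mult_left_mono) auto
    finally have "2 * \<delta> < sum a ?P + (\<Sum>j\<in>?N. - a j)" using \<delta>(1) by simp
    then consider "\<delta> \<le> sum a ?P" | "\<delta> \<le> (\<Sum>j\<in>?N. - a j)" by linarith
    then show ?thesis
    proof cases
      case 1
      then have "good 1 n" unfolding good_def using F(1,2) k(1) by (intro exI[of _ ?P]) auto
      then show ?thesis ..
    next
      case 2
      have "\<exists>k\<in>coeffs x. \<forall>j\<in>?N. \<delta> \<le> k j" using coeffs_uminus[OF k(1)] by (intro bexI[of _ "\<lambda>j. - k j"]) auto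
      then have "good (- 1) n" unfolding good_def using 2 F(1,2) by (intro exI[of _ ?N]) auto
      then show ?thesis ..
    qed
  qed
  moreover have mono: "good s m" if "good s n" "m \<le> n" for s m n
    using that unfolding good_def by (meson order_trans)
  ultimately have "(\<forall>n. good 1 n) \<or> (\<forall>n. good (- 1) n)" by (meson nle_le)
  then obtain s where s: "\<bar>s\<bar> = (1::real)" "\<forall>n. good s n" by (metis abs_1 abs_minus)
  then show ?thesis using that[OF \<delta>(1) s(1)] unfolding good_def by blast
qed

lemma coeffs_comp: "coeffs (x \<circ> r) = (\<lambda>k. k \<circ> r) ` coeffs x"
  unfolding coeffs_def image_image by (simp add: comp_def)

lemma initial_segment_subsequence:
  assumes "strict_mono (r :: nat \<Rightarrow> nat)"
  obtains m where "range r \<inter> {..<n} = r ` {..<m}"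
proof -
  have ex: "n \<le> r n" using assms by (rule strict_mono_imp_increasing)
  define m where "m = (LEAST j. n \<le> r j)"
  have m: "n \<le> r m" unfolding m_def by (rule LeastI[of "\<lambda>j. n \<le> r j", OF ex])
  have "r j < n \<longleftrightarrow> j < m" for j
  proof
    assume "j < m" then show "r j < n" unfolding m_def using not_less_Least not_le by blast
  next
    assume "r j < n"
    then have "r j < r m" using m by simp
    then show "j < m" using assms by (simp add: strict_mono_less)
  qed
  then have "range r \<inter> {..<n} = r ` {..<m}" by auto
  then show ?thesis by (rule that)
qed

text \<open>Coefficients along the subsequence enumerated by \<open>L\<close> are transported to
  coefficients indexed by \<open>L\<close> itself, so that passing to subsequences becomes passing
  to infinite sets for the fixed \<open>coeffs x\<close>.\<close>

lemma ex_witness: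
  fixes x :: "nat \<Rightarrow> 'a::real_normed_vector"
  assumes x: "normalized x" "weakly_null x" and no: "\<And>r. strict_mono r \<Longrightarrow> \<not> bcc (x \<circ> r)"
    and L: "infinite L"
  shows "\<exists>\<delta>>0. \<exists>b. coefficient_set.witness (coeffs x) (coefficient_set.fam (coeffs x) \<delta>) \<delta> L b"
proof -
  interpret coefficient_set "coeffs x" by (rule coefficient_set_coeffs[OF x])
  define r where "r = enumerate L"
  have r: "strict_mono r" "range r = L"
    unfolding r_def using L by (simp_all add: strict_mono_enumerate range_enumerate)
  have inj: "inj r" using r(1) by (rule strict_mono_imp_inj_on)
  let ?z = "x \<circ> r"
  have z: "normalized ?z" "weakly_null ?z" using x normalized_comp weakly_null_comp r(1) by blast+
  obtain a where a: "strongly_bounded (\<lambda>j. a j *\<^sub>R ?z j)" "\<not> (\<lambda>n. tau_n a ?z n) \<longlonglongrightarrow> 0"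
    using no[OF r(1)] z(2) unfolding bcc_def by blast
  obtain M0 where M0: "\<And>n. norm (\<Sum>j<n. a j *\<^sub>R ?z j) \<le> M0" using a(1) unfolding strongly_bounded_def by blast
  define M where "M = max M0 1"
  have M: "norm (\<Sum>j<n. a j *\<^sub>R ?z j) \<le> M" "1 \<le> M" for n using M0[of n] unfolding M_def by auto
  have a_le: "\<bar>a j\<bar> \<le> 2 * M" for j
  proof -
    have "\<bar>a j\<bar> = norm (a j *\<^sub>R ?z j)" using z(1) unfolding normalized_def by simp
    also have "a j *\<^sub>R ?z j = (\<Sum>i<Suc j. a i *\<^sub>R ?z i) - (\<Sum>i<j. a i *\<^sub>R ?z i)" by simp
    also have "norm \<dots> \<le> norm (\<Sum>i<Suc j. a i *\<^sub>R ?z i) + norm (\<Sum>i<j. a i *\<^sub>R ?z i)" by (rule norm_triangle_ineq4)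
    also have "\<dots> \<le> M + M" by (intro add_mono M(1))
    finally show ?thesis by simp
  qed
  obtain \<delta> s where \<delta>: "0 < \<delta>" "\<bar>s\<bar> = 1"
    "\<And>n. \<exists>T. finite T \<and> (\<forall>j\<in>T. n \<le> j \<and> 0 \<le> s * a j) \<and> \<delta> \<le> (\<Sum>j\<in>T. s * a j) \<and> (\<exists>k\<in>coeffs ?z. \<forall>j\<in>T. \<delta> \<le> k j)"
    using not_bcc_same_sign[OF z(1) a(2)] by metis
  \<comment> \<open>Differences of consecutive partial sums bound the entries of \<open>a\<close> by
    \<open>2 * M\<close>, so this factor brings both the entries and the partial sums of
    \<open>b\<close> within 1. As \<open>M\<close> is at least 1, \<open>c * \<delta>\<close> does
    not exceed \<delta>.\<close>
  define c where "c = 1 / (2 * M)"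
  have c: "0 < c" "c \<le> 1" "c * (2 * M) = 1" using M(2) unfolding c_def by auto
  define b where "b i = (if i \<in> L then c * (s * a (inv r i)) else 0)" for i
  have b_r: "b (r j) = c * (s * a j)" for j using r(2) inv_f_f[OF inj] unfolding b_def by auto
  have b_le: "\<bar>b i\<bar> \<le> 1" for i
  proof (cases "i \<in> L")
    case True
    then obtain j where "i = r j" using r(2) by auto
    then have "\<bar>b i\<bar> = c * \<bar>a j\<bar>" using b_r[of j] c(1) \<delta>(2) by (simp add: abs_mult)
    also have "\<dots> \<le> c * (2 * M)" using a_le c(1) by (intro mult_left_mono) auto
    finally show ?thesis using c(3) by simp
  qed (simp add: b_def)
  have b_sum: "\<bar>\<Sum>i<n. b i * k i\<bar> \<le> 1" if k: "k \<in> coeffs x" for k n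
  proof -
    obtain m where m: "range r \<inter> {..<n} = r ` {..<m}" by (rule initial_segment_subsequence[OF r(1)])
    have "(\<Sum>i<n. b i * k i) = (\<Sum>i\<in>range r \<inter> {..<n}. b i * k i)"
      using r(2) by (intro sum.mono_neutral_right) (auto simp: b_def)
    also have "\<dots> = (\<Sum>j<m. b (r j) * k (r j))"
      unfolding m using inj by (subst sum.reindex) (auto intro: inj_on_subset)
    also have "\<dots> = c * s * (\<Sum>j<m. a j * (k \<circ> r) j)" by (simp add: b_r sum_distrib_left mult.assoc)
    finally have "\<bar>\<Sum>i<n. b i * k i\<bar> = c * \<bar>\<Sum>j<m. a j * (k \<circ> r) j\<bar>" using c(1) \<delta>(2) by (simp add: abs_mult)
    also have "\<dots> \<le> c * (2 * M)"
    proof (rule mult_left_mono)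
      have "k \<circ> r \<in> coeffs ?z" using k unfolding coeffs_comp by blast
      then have "\<bar>\<Sum>j<m. a j * (k \<circ> r) j\<bar> \<le> norm (\<Sum>j<m. a j *\<^sub>R ?z j)" by (rule coeffs_le_norm)
      then show "\<bar>\<Sum>j<m. a j * (k \<circ> r) j\<bar> \<le> 2 * M" using M(1)[of m] M(2) by linarith
    qed (use c(1) in simp)
    finally show ?thesis using c(3) by simp
  qed
  have "\<exists>T\<in>fam (c * \<delta>). T \<subseteq> L \<inter> {n..} \<and> (\<forall>i\<in>T. 0 \<le> b i) \<and> c * \<delta> \<le> sum b T" for n
  proof -
    obtain T k where T: "finite T" "\<And>j. j \<in> T \<Longrightarrow> n \<le> j \<and> 0 \<le> s * a j" "\<delta> \<le> (\<Sum>j\<in>T. s * a j)"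
      "k \<in> coeffs ?z" "\<And>j. j \<in> T \<Longrightarrow> \<delta> \<le> k j" using \<delta>(3)[of n] by metis
    obtain k' where k': "k' \<in> coeffs x" "k = k' \<circ> r" using T(4) unfolding coeffs_comp by blast
    have "c * \<delta> \<le> \<delta>" using mult_right_mono[OF c(2), of \<delta>] \<delta>(1) by simp
    then have "c * \<delta> \<le> k' (r j)" if "j \<in> T" for j using T(5)[OF that] k'(2) by simp
    then have "r ` T \<in> fam (c * \<delta>)" unfolding fam_def using T(1) k'(1) by auto
    moreover have "r ` T \<subseteq> L \<inter> {n..}"
      using T(2) r(2) strict_mono_imp_increasing[OF r(1)] by (auto intro: order_trans)
    moreover have "\<forall>i\<in>r ` T. 0 \<le> b i" using T(2) c(1) by (auto simp: b_r)
    moreover have "sum b (r ` T) = c * (\<Sum>j\<in>T. s * a j)"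
      using inj by (subst sum.reindex) (auto intro: inj_on_subset simp: b_r sum_distrib_left)
    moreover have "c * \<delta> \<le> c * (\<Sum>j\<in>T. s * a j)" using T(3) c(1) by (intro mult_left_mono) auto
    ultimately show ?thesis by (intro bexI[of _ "r ` T"]) simp_all
  qed
  then have "witness (fam (c * \<delta>)) (c * \<delta>) L b"
    using b_le b_sum unfolding witness_def bounded_coeffs_def by (auto simp: b_def)
  moreover have "0 < c * \<delta>" using c(1) \<delta>(1) by simp
  ultimately show ?thesis by blast
qed

section \<open>Convex blocks and the two alternatives\<close>

lemma convex_blocks_order:
  fixes D :: "nat \<Rightarrow> nat set"
  assumes D: "\<And>i. finite (D i)" "\<And>i. D i \<noteq> {}" "\<And>i. Max (D i) < Min (D (Suc i))"
    and "i < j" "p \<in> D i" "q \<in> D j"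
  shows "p < q"
proof -
  have "Max (D i) < Min (D j)" using \<open>i < j\<close>
  proof (induction j)
    case (Suc j)
    show ?case
    proof (cases "i = j")
      case True then show ?thesis using D(3) by blast
    next
      case False
      then have "Max (D i) < Min (D j)" using Suc by simp
      also have "Min (D j) \<le> Max (D j)" using D(1,2) by (simp add: Max_ge)
      also have "\<dots> < Min (D (Suc j))" by (rule D(3))
      finally show ?thesis .
    qed
  qed simp
  moreover have "p \<le> Max (D i)" "Min (D j) \<le> q" using D(1) assms(5,6) by auto
  ultimately show ?thesis by simp
qed

text \<open>\<open>convex_block_subseq\<close> asks for one coefficient function for all blocks,
  whereas the construction supplies one measure per block. The value 0 off the blocks matters when
  partial sums are estimated.\<close>

lemma disjoint_blocks_choice:
  fixes D :: "nat \<Rightarrow> nat set" and \<nu> :: "nat \<Rightarrow> nat \<Rightarrow> real"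
  assumes disj: "\<And>i j n. n \<in> D i \<Longrightarrow> n \<in> D j \<Longrightarrow> i = j" and pos: "\<And>i n. 0 \<le> \<nu> i n"
  shows "\<exists>c. (\<forall>n. 0 \<le> c n) \<and> (\<forall>i. \<forall>n\<in>D i. c n = \<nu> i n) \<and> (\<forall>n. n \<notin> (\<Union>i. D i) \<longrightarrow> c n = 0)"
proof -
  define c where "c n = (if n \<in> (\<Union>i. D i) then \<nu> (SOME i. n \<in> D i) n else 0)" for n
  have "c n = \<nu> i n" if "n \<in> D i" for i n
  proof -
    have "(SOME i. n \<in> D i) = i" by (rule some_equality, rule that, rule disj, assumption, rule that)
    then show ?thesis using that unfolding c_def by auto
  qed
  moreover have "0 \<le> c n" for n using pos unfolding c_def by simp
  moreover have "c n = 0" if "n \<notin> (\<Union>i. D i)" for n using that unfolding c_def by simp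
  ultimately show ?thesis by blast
qed

text \<open>A functional that is at least \<delta> on \<open>D i\<close> bounds the block from below
  by \<delta>. For the upper estimate, a combination of blocks is normed by one functional, whose
  absolute values on the blocks have bounded sum.\<close>

lemma ex_c0_convex_blocks:
  fixes x :: "nat \<Rightarrow> 'a::real_normed_vector"
  assumes x: "normalized x" "weakly_null x" and no: "\<And>r. strict_mono r \<Longrightarrow> \<not> bcc (x \<circ> r)"
  shows "\<exists>y. convex_block_subseq y x \<and> equiv_c0_basis y"
proof -
  interpret coefficient_set "coeffs x" by (rule coefficient_set_coeffs[OF x])
  obtain \<delta> where \<delta>: "0 < \<delta>" "c0_blocks \<delta> UNIV" using ex_c0_blocks ex_witness[OF x no] by blast
  then obtain D \<nu> C where DC: "\<forall>i. D i \<subseteq> UNIV \<and> D i \<in> fam \<delta> \<and> (\<forall>j. 0 \<le> \<nu> i j) \<and> sum (\<nu> i) (D i) = 1 \<and>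
      Max (D i) < Min (D (Suc i))"
    and C: "\<forall>k\<in>coeffs x. \<forall>n. (\<Sum>i<n. \<bar>\<Sum>j\<in>D i. \<nu> i j * k j\<bar>) \<le> C"
    unfolding c0_blocks_def by (elim exE conjE) (rule that)
  have D: "D i \<in> fam \<delta>" "\<And>j. 0 \<le> \<nu> i j" "sum (\<nu> i) (D i) = 1" "Max (D i) < Min (D (Suc i))" for i
    using DC by simp_all
  have fD: "finite (D i)" "D i \<noteq> {}" for i using D(1,3)[of i] unfolding fam_def by auto
  define y where "y i = (\<Sum>j\<in>D i. \<nu> i j *\<^sub>R x j)" for i
  have disj: "i = j" if "n \<in> D i" "n \<in> D j" for i j n
    using convex_blocks_order[where D = D, OF fD D(4)] that by (metis linorder_neqE_nat less_irrefl)
  have "\<exists>c. (\<forall>n. 0 \<le> c n) \<and> (\<forall>i. \<forall>n\<in>D i. c n = \<nu> i n) \<and> (\<forall>n. n \<notin> (\<Union>i. D i) \<longrightarrow> c n = 0)"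
    using disj D(2) by (rule disjoint_blocks_choice)
  then obtain c where c: "\<And>n. 0 \<le> c n" "\<And>i n. n \<in> D i \<Longrightarrow> c n = \<nu> i n" by blast
  have blocks: "convex_block_subseq y x"
    unfolding convex_block_subseq_def
  proof (intro exI conjI allI)
    show "finite (D i)" "D i \<noteq> {}" "Max (D i) < Min (D (Suc i))" for i using fD D(4) by auto
    show "0 \<le> c n" for n by (rule c(1))
    show "(\<Sum>n\<in>D i. c n) = 1" for i using D(3)[of i] c(2) by (metis sum.cong)
    show "y i = (\<Sum>n\<in>D i. c n *\<^sub>R x n)" for i unfolding y_def using c(2) by (intro sum.cong) auto
  qed
  have y_ge: "\<delta> \<le> norm (y i)" for i
  proof -
    obtain k where k: "k \<in> coeffs x" "\<And>j. j \<in> D i \<Longrightarrow> \<delta> \<le> k j" using D(1)[of i] unfolding fam_def by auto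
    have "\<delta> = (\<Sum>j\<in>D i. \<nu> i j * \<delta>)" using D(3)[of i] by (simp add: sum_distrib_right[symmetric])
    also have "\<dots> \<le> (\<Sum>j\<in>D i. \<nu> i j * k j)" using k(2) D(2) by (intro sum_mono mult_left_mono) auto
    also have "\<dots> \<le> norm (y i)"
      using coeffs_le_norm[OF k(1), of "\<nu> i" "D i"] unfolding y_def by linarith
    finally show ?thesis .
  qed
  have "norm (y i) \<le> 1" for i
    using norm_sum_le[OF x(1), of "\<nu> i" "D i"] D(2,3)[of i] unfolding y_def by simp
  then have "bdd_above (range (\<lambda>i. norm (y i)))" by (intro bdd_aboveI2)
  moreover have "\<delta> \<le> (INF i. norm (y i))" using y_ge by (intro cINF_greatest) auto
  ultimately have "semi_normalized y" using \<delta>(1) unfolding semi_normalized_def by linarith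
  moreover have "norm (\<Sum>i\<le>n. a i *\<^sub>R y i) \<le> max C 1 * (MAX i\<in>{..n}. \<bar>a i\<bar>)" for a :: "nat \<Rightarrow> real" and n
  proof -
    let ?m = "MAX i\<in>{..n}. \<bar>a i\<bar>"
    have m: "\<bar>a i\<bar> \<le> ?m" if "i \<le> n" for i using that by (intro Max_ge) auto
    then have "0 \<le> ?m" using order_trans[OF abs_ge_zero m[of n]] by simp
    obtain f where f: "f \<in> dual_ball" "f (\<Sum>i\<le>n. a i *\<^sub>R y i) = norm (\<Sum>i\<le>n. a i *\<^sub>R y i)"
      using dual_ball_norming by blast
    have lin: "linear f" using f(1) unfolding dual_ball_def by blast
    define k where "k = (\<lambda>j. f (x j))"
    have k: "k \<in> coeffs x" using f(1) unfolding k_def coeffs_def by blast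
    have fy: "f (y i) = (\<Sum>j\<in>D i. \<nu> i j * k j)" for i
      unfolding y_def k_def by (rule linear_sum_scaleR[OF lin])
    have "norm (\<Sum>i\<le>n. a i *\<^sub>R y i) = (\<Sum>i\<le>n. a i * f (y i))"
      using f(2) linear_sum_scaleR[OF lin, of a y "{..n}"] by simp
    also have "\<dots> \<le> (\<Sum>i\<le>n. ?m * \<bar>f (y i)\<bar>)"
    proof (rule sum_mono)
      fix i assume "i \<in> {..n}"
      have "a i * f (y i) \<le> \<bar>a i\<bar> * \<bar>f (y i)\<bar>" by (metis abs_ge_self abs_mult)
      also have "\<dots> \<le> ?m * \<bar>f (y i)\<bar>" using m \<open>i \<in> {..n}\<close> by (intro mult_right_mono) auto
      finally show "a i * f (y i) \<le> ?m * \<bar>f (y i)\<bar>" .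
    qed
    also have "\<dots> = ?m * (\<Sum>i<Suc n. \<bar>f (y i)\<bar>)" by (simp only: sum_distrib_left lessThan_Suc_atMost)
    also have "\<dots> \<le> ?m * max C 1"
    proof (rule mult_left_mono[OF _ \<open>0 \<le> ?m\<close>])
      have "(\<Sum>i<Suc n. \<bar>f (y i)\<bar>) \<le> C" unfolding fy using C k by blast
      then show "(\<Sum>i<Suc n. \<bar>f (y i)\<bar>) \<le> max C 1" by simp
    qed
    finally show ?thesis by (simp add: mult.commute)
  qed
  ultimately show ?thesis 
    unfolding equiv_c0_basis_def using blocks by (intro exI[of _ y] conjI exI[of _ "max C 1"]) auto
qed

text \<open>A partial sum consists of complete blocks, bounded by \<open>C\<close> through constant
  coefficients 1, and of part of one further block, of norm at most 1 by convexity. Yet block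
  \<open>n\<close> lies beyond \<open>n\<close> and has total mass 1, so it keeps
  \<open>tau_n\<close> above the infimum of the block norms.\<close>

lemma not_bcc_if_c0_convex_blocks:
  fixes z :: "nat \<Rightarrow> 'a::real_normed_vector"
  assumes z: "normalized z" and y: "convex_block_subseq y z" "equiv_c0_basis y"
  shows "\<not> bcc z"
proof
  assume bcc: "bcc z"
  obtain F c where Fc: "(\<forall>i. finite (F i) \<and> F i \<noteq> {}) \<and> (\<forall>i. Max (F i) < Min (F (Suc i))) \<and>
     (\<forall>n. 0 \<le> c n) \<and> (\<forall>i. (\<Sum>n\<in>F i. c n) = 1) \<and> (\<forall>i. y i = (\<Sum>n\<in>F i. c n *\<^sub>R z n))"
    using y(1) unfolding convex_block_subseq_def by (elim exE) (rule that)
  then have F: "finite (F i)" "F i \<noteq> {}" "Max (F i) < Min (F (Suc i))" "(\<Sum>n\<in>F i. c n) = 1"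
    "y i = (\<Sum>n\<in>F i. c n *\<^sub>R z n)" for i by auto
  have c: "0 \<le> c n" for n using Fc by auto
  note less = convex_blocks_order[where D = F, OF F(1-3)]
  have disj: "i = j" if "n \<in> F i" "n \<in> F j" for i j n
    using less that by (metis linorder_neqE_nat less_irrefl)
  \<comment> \<open>The function \<open>c\<close> is arbitrary nonnegative off the blocks;
    \<open>a\<close> replaces it by 0 there.\<close>
  have "\<exists>a. (\<forall>n. 0 \<le> a n) \<and> (\<forall>i. \<forall>n\<in>F i. a n = c n) \<and> (\<forall>n. n \<notin> (\<Union>i. F i) \<longrightarrow> a n = 0)"
    using disj c by (rule disjoint_blocks_choice)
  then obtain a where a: "\<And>n. 0 \<le> a n" "\<And>i n. n \<in> F i \<Longrightarrow> a n = c n" "\<And>n. n \<notin> (\<Union>i. F i) \<Longrightarrow> a n = 0"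
    by blast
  have ya: "y i = (\<Sum>n\<in>F i. a n *\<^sub>R z n)" for i unfolding F(5) using a(2) by (intro sum.cong) auto
  have a1: "(\<Sum>n\<in>F i. a n) = 1" for i using F(4)[of i] a(2) by (metis sum.cong)
  obtain C where C: "0 < C" "\<And>b n. norm (\<Sum>i\<le>n. b i *\<^sub>R y i) \<le> C * (MAX i\<in>{..n}. \<bar>b i\<bar>)"
    using y(2) unfolding equiv_c0_basis_def by blast
  have sum_y: "norm (\<Sum>i<n. y i) \<le> C" for n
  proof (cases n)
    case 0 then show ?thesis using C(1) by simp
  next
    case (Suc m)
    then show ?thesis using C(2)[of "\<lambda>_. 1" m] by (simp add: lessThan_Suc_atMost image_constant_conv)
  qed
  have F_ge: "i \<le> n" if "n \<in> F i" for i n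
    using that
  proof (induction i arbitrary: n)
    case (Suc i)
    obtain p where "p \<in> F i" using F(2) by blast
    then have "i \<le> p" "p < n" using Suc.IH less[of i "Suc i" p n] Suc.prems by auto
    then show ?case by simp
  qed simp
  have "norm (\<Sum>j<n. a j *\<^sub>R z j) \<le> C + 1" for n
  proof -
    have ex: "n \<le> Max (F n)" using F_ge[OF Max_in[OF F(1,2)]] .
    define p where "p = (LEAST i. n \<le> Max (F i))"
    have p: "n \<le> Max (F p)" unfolding p_def by (rule LeastI[of "\<lambda>i. n \<le> Max (F i)", OF ex])
    have below: "j < n" if "i < p" "j \<in> F i" for i j
    proof -
      have "Max (F i) < n" using that(1) not_less_Least unfolding p_def by (meson not_le)
      then show ?thesis using Max_ge[OF F(1) that(2)] by simp
    qed
    have above: "n \<le> j" if "p < i" "j \<in> F i" for i j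
      using less[OF that(1) Max_in[OF F(1,2)] that(2)] p by simp
    have eq: "(\<Union>i. F i) \<inter> {..<n} = (\<Union>i<p. F i) \<union> F p \<inter> {..<n}"
    proof
      show "(\<Union>i. F i) \<inter> {..<n} \<subseteq> (\<Union>i<p. F i) \<union> F p \<inter> {..<n}"
      proof
        fix j assume j: "j \<in> (\<Union>i. F i) \<inter> {..<n}"
        then obtain i where i: "j \<in> F i" by blast
        have "\<not> p < i" using above[OF _ i] j by auto
        then show "j \<in> (\<Union>i<p. F i) \<union> F p \<inter> {..<n}" using i j by (cases "i = p") auto
      qed
    qed (use below in auto)
    have "(\<Sum>j<n. a j *\<^sub>R z j) = (\<Sum>j\<in>(\<Union>i. F i) \<inter> {..<n}. a j *\<^sub>R z j)"
      using a(3) by (intro sum.mono_neutral_right) auto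
    also have "\<dots> = (\<Sum>j\<in>(\<Union>i<p. F i). a j *\<^sub>R z j) + (\<Sum>j\<in>F p \<inter> {..<n}. a j *\<^sub>R z j)"
      unfolding eq
    proof (rule sum.union_disjoint)
      show "(\<Union>i<p. F i) \<inter> (F p \<inter> {..<n}) = {}" using disj by (metis (no_types, lifting) Int_iff UN_E disjoint_iff lessThan_iff less_irrefl)
    qed (use F(1) in auto)
    also have "(\<Sum>j\<in>(\<Union>i<p. F i). a j *\<^sub>R z j) = (\<Sum>i<p. \<Sum>j\<in>F i. a j *\<^sub>R z j)"
    proof (rule sum.UNION_disjoint)
      show "\<forall>i\<in>{..<p}. \<forall>j\<in>{..<p}. i \<noteq> j \<longrightarrow> F i \<inter> F j = {}" using disj by blast
    qed (use F(1) in auto)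
    also have "\<dots> = (\<Sum>i<p. y i)" using ya by simp
    finally have "norm (\<Sum>j<n. a j *\<^sub>R z j) \<le> norm (\<Sum>i<p. y i) + norm (\<Sum>j\<in>F p \<inter> {..<n}. a j *\<^sub>R z j)"
      by (simp add: norm_triangle_ineq)
    moreover have "norm (\<Sum>j\<in>F p \<inter> {..<n}. a j *\<^sub>R z j) \<le> (\<Sum>j\<in>F p \<inter> {..<n}. \<bar>a j\<bar>)" by (rule norm_sum_le[OF z])
    moreover have "(\<Sum>j\<in>F p \<inter> {..<n}. \<bar>a j\<bar>) \<le> (\<Sum>j\<in>F p. \<bar>a j\<bar>)" using F(1) by (intro sum_mono2) auto
    moreover have "(\<Sum>j\<in>F p. \<bar>a j\<bar>) = 1" using a(1) a1[of p] by simp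
    ultimately show ?thesis using sum_y[of p] by linarith
  qed
  then have "strongly_bounded (\<lambda>j. a j *\<^sub>R z j)" unfolding strongly_bounded_def by blast
  then have lim: "(\<lambda>n. tau_n a z n) \<longlonglongrightarrow> 0" using bcc unfolding bcc_def by blast
  define d where "d = (INF i. norm (y i))"
  have d: "0 < d" "d \<le> norm (y i)" for i
  proof -
    show "0 < d" using y(2) unfolding equiv_c0_basis_def semi_normalized_def d_def by blast
    show "d \<le> norm (y i)" unfolding d_def by (rule cINF_lower[OF bdd_belowI2[of _ 0]]) auto
  qed
  have "d \<le> tau_n a z n" for n
  proof -
    have "norm (\<Sum>j\<in>F n. a j *\<^sub>R z j) \<le> tau_n a z n"
      using F_ge a(1) a1[of n] by (intro tau_n_ge[OF z F(1)]) auto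
    then show ?thesis using d(2)[of n] ya[of n] by simp
  qed
  then have "d \<le> 0" by (intro LIMSEQ_le_const[OF lim]) auto
  then show False using d(1) by simp
qed

theorem theorem1p3:
  fixes x :: "nat \<Rightarrow> 'a::banach"
  assumes "normalized x" and "bimonotone x" and "weakly_null x"
  shows "((\<exists>r. strict_mono r \<and> bcc (x \<circ> r)) \<or>
          (\<forall>r. strict_mono r \<longrightarrow> (\<exists>y. convex_block_subseq y (x \<circ> r) \<and> equiv_c0_basis y)))
       \<and> \<not> ((\<exists>r. strict_mono r \<and> bcc (x \<circ> r)) \<and>
          (\<forall>r. strict_mono r \<longrightarrow> (\<exists>y. convex_block_subseq y (x \<circ> r) \<and> equiv_c0_basis y)))"
proof (intro conjI disjCI)
  assume "\<not> (\<forall>r. strict_mono r \<longrightarrow> (\<exists>y. convex_block_subseq y (x \<circ> r) \<and> equiv_c0_basis y))"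
  then obtain r where r: "strict_mono r" "\<not> (\<exists>y. convex_block_subseq y (x \<circ> r) \<and> equiv_c0_basis y)" by blast
  then obtain q where q: "strict_mono q" "bcc (x \<circ> r \<circ> q)"
    using ex_c0_convex_blocks[OF normalized_comp[OF assms(1)] weakly_null_comp[OF assms(3) r(1)]] by blast
  then show "\<exists>r. strict_mono r \<and> bcc (x \<circ> r)"
    using strict_mono_o[OF r(1) q(1)] by (auto simp: comp_assoc)
next
  show "\<not> ((\<exists>r. strict_mono r \<and> bcc (x \<circ> r)) \<and>
          (\<forall>r. strict_mono r \<longrightarrow> (\<exists>y. convex_block_subseq y (x \<circ> r) \<and> equiv_c0_basis y)))"
    using not_bcc_if_c0_convex_blocks[OF normalized_comp[OF assms(1)]] by blast
qed

end
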